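(* Let $p\in K$, let $M$ be a parameterized Picard–Vessiot extension of $K$ for the equation $\delta^2Y-p\,\delta Y=0$, and let $\eta\in M$ satisfy $\delta^2\eta=p\,\delta\eta$ and $\delta\eta\neq 0$. Then $\eta$ is $\partial$-transcendental over $K$ if and only if both of the following hold: (1) the equation $\delta Y=\partial p$ has no solution $Y\in K$; (2) the equation $\delta Y+pY=1$ has no solution $Y\in K$.
   Context: All fields have characteristic zero. A $\Delta$-field is a field with a finite set $\Delta$ of pairwise commuting derivations. A $\partial$-field $F$ is differentially closed ($\partial$-closed) if every system of polynomial differential equations over $F$ that has a solution in some $\partial$-field extension of $F$ already has a solution in $F$. Let $F$ be a differentially closed $\partial$-field. Let $K:=F(x)$, made into a $\Delta=\{\delta,\partial\}$-field by $\delta x=1$, $\partial x=0$, $\delta|_F=0$, with $\partial$ on $F$ the given derivation; then $K^\delta=F$. An element $y$ of a $\Delta$-field extension of $K$ is $\partial$-transcendental over $K$ if $y,\partial y,\partial^2y,\dots$ are algebraically independent over $K$. For a linear equation $\delta^nY+\sum_{i<n}r_i\delta^iY=0$ with $r_i\in K$, a parameterized Picard–Vessiot (PPV) extension is a $\Delta$-field extension $M\supseteq K$ such that: there are $n$ solutions $y_1,\dots,y_n\in M$ that are linearly independent over $K^\delta$; $M$ is generated as a $\Delta$-field over $K$ by $y_1,\dots,y_n$ (i.e., by all their iterated $\delta$- and $\partial$-derivatives); and $M^\delta=K^\delta$. *)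

theory Defs
  imports Main "HOL-Algebra.Ring"
begin

definition is_derivation :: "('a::field \<Rightarrow> 'a) \<Rightarrow> bool" where
  "is_derivation D \<longleftrightarrow> (\<forall>a b. D (a + b) = D a + D b \<and> D (a * b) = a * D b + D a * b)"

definition is_subfield :: "'a::field set \<Rightarrow> bool" where
  "is_subfield S \<longleftrightarrow> 0 \<in> S \<and> 1 \<in> S \<and>
     (\<forall>a\<in>S. \<forall>b\<in>S. a + b \<in> S \<and> a * b \<in> S) \<and>
     (\<forall>a\<in>S. - a \<in> S \<and> inverse a \<in> S)"

definition field_gen :: "'a::field set \<Rightarrow> 'a set" where
  "field_gen A = \<Inter> {S. is_subfield S \<and> A \<subseteq> S}"

definition delta_field_gen :: "('a::field \<Rightarrow> 'a) \<Rightarrow> ('a \<Rightarrow> 'a) \<Rightarrow> 'a set \<Rightarrow> 'a set" where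
  "delta_field_gen dl dp A =
     \<Inter> {S. is_subfield S \<and> A \<subseteq> S \<and> dl ` S \<subseteq> S \<and> dp ` S \<subseteq> S}"

definition consts_of :: "('a::field \<Rightarrow> 'a) \<Rightarrow> 'a set \<Rightarrow> 'a set" where
  "consts_of D S = {a \<in> S. D a = 0}"

definition transcendental_over :: "'a::field set \<Rightarrow> 'a \<Rightarrow> bool" where
  "transcendental_over F x \<longleftrightarrow>
     (\<forall>(c :: nat \<Rightarrow> 'a) n. (\<forall>i\<le>n. c i \<in> F) \<and> (\<Sum>i\<le>n. c i * x ^ i) = 0 \<longrightarrow> (\<forall>i\<le>n. c i = 0))"

definition alg_indep_over :: "'a::field set \<Rightarrow> (nat \<Rightarrow> 'a) \<Rightarrow> bool" where
  "alg_indep_over K f \<longleftrightarrow>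
     (\<forall>c :: (nat \<Rightarrow> nat) \<Rightarrow> 'a.
        finite {m. c m \<noteq> 0} \<and> (\<forall>m. c m \<noteq> 0 \<longrightarrow> finite {i. m i \<noteq> 0}) \<and>
        (\<forall>m. c m \<in> K) \<and>
        (\<Sum>m\<in>{m. c m \<noteq> 0}. c m * (\<Prod>i\<in>{i. m i \<noteq> 0}. f i ^ m i)) = 0
        \<longrightarrow> (\<forall>m. c m = 0))"

definition d_transcendental_over :: "('a::field \<Rightarrow> 'a) \<Rightarrow> 'a set \<Rightarrow> 'a \<Rightarrow> bool" where
  "d_transcendental_over dp K y \<longleftrightarrow> alg_indep_over K (\<lambda>i. (dp ^^ i) y)"

text \<open>Differential polynomials with coefficients of type 'c in the differential
  indeterminates y_0, y_1, ...; Var j k stands for the k-th derivative of y_j.\<close>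
datatype 'c dpoly = Const 'c | Var nat nat | Add "'c dpoly" "'c dpoly"
  | Mul "'c dpoly" "'c dpoly" | Neg "'c dpoly"

primrec dpoly_coeffs :: "'c dpoly \<Rightarrow> 'c set" where
  "dpoly_coeffs (Const c) = {c}"
| "dpoly_coeffs (Var j k) = {}"
| "dpoly_coeffs (Add p q) = dpoly_coeffs p \<union> dpoly_coeffs q"
| "dpoly_coeffs (Mul p q) = dpoly_coeffs p \<union> dpoly_coeffs q"
| "dpoly_coeffs (Neg p) = dpoly_coeffs p"

primrec deval :: "('a::field \<Rightarrow> 'a) \<Rightarrow> (nat \<Rightarrow> 'a) \<Rightarrow> 'a dpoly \<Rightarrow> 'a" where
  "deval D z (Const c) = c"
| "deval D z (Var j k) = (D ^^ k) (z j)"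
| "deval D z (Add p q) = deval D z p + deval D z q"
| "deval D z (Mul p q) = deval D z p * deval D z q"
| "deval D z (Neg p) = - deval D z p"

primrec deval_ext :: "('c \<Rightarrow> 'b) \<Rightarrow> ('b, 'm) ring_scheme \<Rightarrow> ('b \<Rightarrow> 'b) \<Rightarrow> (nat \<Rightarrow> 'b) \<Rightarrow> 'c dpoly \<Rightarrow> 'b" where
  "deval_ext h E DE y (Const c) = h c"
| "deval_ext h E DE y (Var j k) = (DE ^^ k) (y j)"
| "deval_ext h E DE y (Add p q) = deval_ext h E DE y p \<oplus>\<^bsub>E\<^esub> deval_ext h E DE y q"
| "deval_ext h E DE y (Mul p q) = deval_ext h E DE y p \<otimes>\<^bsub>E\<^esub> deval_ext h E DE y q"
| "deval_ext h E DE y (Neg p) = \<ominus>\<^bsub>E\<^esub> deval_ext h E DE y p"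

definition is_dfield_ext :: "'a::field set \<Rightarrow> ('a \<Rightarrow> 'a) \<Rightarrow> ('b, 'm) ring_scheme \<Rightarrow> ('b \<Rightarrow> 'b) \<Rightarrow> ('a \<Rightarrow> 'b) \<Rightarrow> bool" where
  "is_dfield_ext F D E DE h \<longleftrightarrow>
     field E \<and>
     (\<forall>a\<in>carrier E. DE a \<in> carrier E) \<and>
     (\<forall>a\<in>carrier E. \<forall>b\<in>carrier E.
        DE (a \<oplus>\<^bsub>E\<^esub> b) = DE a \<oplus>\<^bsub>E\<^esub> DE b \<and>
        DE (a \<otimes>\<^bsub>E\<^esub> b) = (a \<otimes>\<^bsub>E\<^esub> DE b) \<oplus>\<^bsub>E\<^esub> (DE a \<otimes>\<^bsub>E\<^esub> b)) \<and>
     (\<forall>a\<in>F. h a \<in> carrier E) \<and> inj_on h F \<and> h 1 = \<one>\<^bsub>E\<^esub> \<and>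
     (\<forall>a\<in>F. \<forall>b\<in>F. h (a + b) = h a \<oplus>\<^bsub>E\<^esub> h b \<and> h (a * b) = h a \<otimes>\<^bsub>E\<^esub> h b) \<and>
     (\<forall>a\<in>F. DE (h a) = h (D a))"

text \<open>(F, D) is differentially closed: every system (finite list) of differential
  polynomial equations over F that has a solution in some differential field
  extension of F already has a solution in F.  Extensions are taken with carrier in
  the ambient type 'a; since a differential field extension generated over the
  infinite field F by finitely many elements has cardinality |F| <= |'a|, every
  such extension is (up to isomorphism) of this form.\<close>
definition d_closed :: "'a::field_char_0 set \<Rightarrow> ('a \<Rightarrow> 'a) \<Rightarrow> bool" where
  "d_closed F D \<longleftrightarrow>
     (\<forall>(E :: 'a ring) DE h (y :: nat \<Rightarrow> 'a) (sys :: 'a dpoly list).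
        is_dfield_ext F D E DE h \<and> (\<forall>j. y j \<in> carrier E) \<and>
        (\<forall>e\<in>set sys. dpoly_coeffs e \<subseteq> F) \<and>
        (\<forall>e\<in>set sys. deval_ext h E DE y e = \<zero>\<^bsub>E\<^esub>)
        \<longrightarrow> (\<exists>z. (\<forall>j. z j \<in> F) \<and> (\<forall>e\<in>set sys. deval D z e = 0)))"

definition solves_lde :: "('a::field \<Rightarrow> 'a) \<Rightarrow> nat \<Rightarrow> (nat \<Rightarrow> 'a) \<Rightarrow> 'a \<Rightarrow> bool" where
  "solves_lde dl n r y \<longleftrightarrow> (dl ^^ n) y + (\<Sum>i<n. r i * (dl ^^ i) y) = 0"

definition lin_indep_over :: "'a::field set \<Rightarrow> nat \<Rightarrow> (nat \<Rightarrow> 'a) \<Rightarrow> bool" where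
  "lin_indep_over C n y \<longleftrightarrow>
     (\<forall>c. (\<forall>i<n. c i \<in> C) \<and> (\<Sum>i<n. c i * y i) = 0 \<longrightarrow> (\<forall>i<n. c i = 0))"

definition is_PPV :: "('a::field \<Rightarrow> 'a) \<Rightarrow> ('a \<Rightarrow> 'a) \<Rightarrow> 'a set \<Rightarrow> nat \<Rightarrow> (nat \<Rightarrow> 'a) \<Rightarrow> 'a set \<Rightarrow> bool" where
  "is_PPV dl dp K n r M \<longleftrightarrow>
     (\<exists>y :: nat \<Rightarrow> 'a.
        (\<forall>i<n. y i \<in> M \<and> solves_lde dl n r (y i)) \<and>
        lin_indep_over (consts_of dl K) n y \<and>
        M = delta_field_gen dl dp (K \<union> y ` {..<n})) \<and>
     consts_of dl M = consts_of dl K"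

end

theory Submission
  imports Defs "HOL-Computational_Algebra.Polynomial"
begin

text \<open>Put \<open>g = \<delta> \<eta>\<close>, \<open>h = \<partial> g / g\<close>, \<open>h\<^sub>i = \<partial>\<^sup>i h\<close>. Then \<open>\<delta> h\<^sub>i = \<partial>\<^sup>i\<^sup>+\<^sup>1 p\<close> lies in \<open>K\<close>, and
  \<open>\<delta> \<partial>\<^sup>i \<eta> = H\<^sub>i g\<close> where \<open>H\<^sub>i\<close> is a polynomial in the \<open>h\<^sub>j\<close> with leading form \<open>h\<^sup>i\<close>.

  If an equation is solvable, creative telescoping over \<open>F(x)\<close> (the cokernel of \<open>\<delta> + p\<close> on rational
  functions with prescribed poles is finite-dimensional over \<open>F\<close>) gives an \<open>F\<close>-linear relation
  among the \<open>H\<^sub>i\<close> modulo the image of \<open>\<delta> + p\<close>, or among the \<open>\<partial>\<^sup>i\<^sup>+\<^sup>1 p\<close> modulo that of \<open>\<delta>\<close>. Integrating it, the field generated over \<open>K\<close> by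
  \<open>\<eta>, \<dots>, \<partial>\<^sup>n \<eta>\<close> contains \<open>\<partial>\<^sup>n\<^sup>+\<^sup>1 \<eta>\<close> for some \<open>n\<close>.

  Conversely, let \<open>\<eta>\<close> be \<open>\<partial>\<close>-algebraic and the first equation unsolvable. Then \<open>g\<close> is transcendental
  over \<open>K(h\<^sub>0, h\<^sub>1, \<dots>)\<close>, and Ostrowski's theorem on algebraic relations between primitives gives
  \<open>\<delta> b + p b = H\<^sub>m - \<Sum>c\<^sub>i H\<^sub>i\<close> with \<open>b\<close> in \<open>K(h\<^sub>0, \<dots>, h\<^sub>m\<^sub>-\<^sub>1)\<close>. As \<open>\<delta> + p\<close> is injective there,
  \<open>b\<close> is a polynomial in \<open>h\<close> whose coefficient of \<open>h\<^sup>m\<close> solves \<open>\<delta> Y + p Y = 1\<close>, and that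
  coefficient descends to \<open>K\<close>.\<close>

section \<open>Subfields\<close>

lemma is_subfieldD:
  assumes "is_subfield S"
  shows subfield_zero: "0 \<in> S" and subfield_one: "1 \<in> S"
    and subfield_add: "\<And>a b. a \<in> S \<Longrightarrow> b \<in> S \<Longrightarrow> a + b \<in> S"
    and subfield_mult: "\<And>a b. a \<in> S \<Longrightarrow> b \<in> S \<Longrightarrow> a * b \<in> S"
    and subfield_uminus: "\<And>a. a \<in> S \<Longrightarrow> - a \<in> S"
    and subfield_inverse: "\<And>a. a \<in> S \<Longrightarrow> inverse a \<in> S"
  using assms by (auto simp: is_subfield_def)

lemma is_subfieldI:
  assumes "0 \<in> S" "1 \<in> S" "\<And>a b. a \<in> S \<Longrightarrow> b \<in> S \<Longrightarrow> a + b \<in> S"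
    "\<And>a b. a \<in> S \<Longrightarrow> b \<in> S \<Longrightarrow> a * b \<in> S" "\<And>a. a \<in> S \<Longrightarrow> - a \<in> S"
    "\<And>a. a \<in> S \<Longrightarrow> inverse a \<in> S"
  shows "is_subfield S"
  using assms by (simp add: is_subfield_def)

lemma subfield_diff: "is_subfield S \<Longrightarrow> a \<in> S \<Longrightarrow> b \<in> S \<Longrightarrow> a - b \<in> S"
  using subfield_add[of S a "- b"] subfield_uminus[of S b] by simp

lemma subfield_divide: "is_subfield S \<Longrightarrow> a \<in> S \<Longrightarrow> b \<in> S \<Longrightarrow> a / b \<in> S"
  by (simp add: divide_inverse subfield_mult subfield_inverse)

lemma subfield_power: "is_subfield S \<Longrightarrow> a \<in> S \<Longrightarrow> a ^ n \<in> S"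
  by (induction n) (auto intro: subfield_one subfield_mult)

lemma subfield_sum: "is_subfield S \<Longrightarrow> (\<And>i. i \<in> I \<Longrightarrow> f i \<in> S) \<Longrightarrow> sum f I \<in> S"
  by (induction I rule: infinite_finite_induct) (auto intro: subfield_zero subfield_add)

lemma subfield_of_nat: "is_subfield S \<Longrightarrow> of_nat n \<in> S"
  by (induction n) (auto intro: subfield_zero subfield_one subfield_add)

lemmas subfield_intros = subfield_zero subfield_one subfield_add subfield_mult subfield_uminus
  subfield_inverse subfield_diff subfield_divide subfield_power subfield_sum subfield_of_nat

lemma subfield_mult_cancel:
  assumes "is_subfield S" "a \<in> S" "a \<noteq> 0" "a * b \<in> S"
  shows "b \<in> S"
  using subfield_divide[OF assms(1,4,2)] assms(3) by simp

lemma is_subfield_Inter: "(\<And>S. S \<in> \<S> \<Longrightarrow> is_subfield S) \<Longrightarrow> is_subfield (\<Inter>\<S>)"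
  by (auto simp: is_subfield_def)

lemma is_subfield_field_gen: "is_subfield (field_gen A)"
  unfolding field_gen_def by (rule is_subfield_Inter) auto

lemma subset_field_gen: "A \<subseteq> field_gen A"
  by (auto simp: field_gen_def)

lemma field_gen_least: "is_subfield S \<Longrightarrow> A \<subseteq> S \<Longrightarrow> field_gen A \<subseteq> S"
  by (auto simp: field_gen_def)

lemma field_gen_mono: "A \<subseteq> B \<Longrightarrow> field_gen A \<subseteq> field_gen B"
  by (auto simp: field_gen_def)

lemma field_gen_insert_eq: "field_gen (field_gen A \<union> B) = field_gen (A \<union> B)"
proof
  show "field_gen (field_gen A \<union> B) \<subseteq> field_gen (A \<union> B)"
    using subset_field_gen[of "A \<union> B"]
    by (intro field_gen_least is_subfield_field_gen Un_least field_gen_mono) auto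
  show "field_gen (A \<union> B) \<subseteq> field_gen (field_gen A \<union> B)"
    using subset_field_gen[of A] by (intro field_gen_mono) auto
qed

lemma field_gen_eq: "is_subfield S \<Longrightarrow> field_gen S = S"
  using field_gen_least[of S S] subset_field_gen[of S] by auto

section \<open>Polynomials with coefficients in a subset\<close>

definition is_subring :: "'a::field set \<Rightarrow> bool" where
  "is_subring R \<longleftrightarrow> 0 \<in> R \<and> 1 \<in> R \<and> (\<forall>a\<in>R. \<forall>b\<in>R. a + b \<in> R \<and> a * b \<in> R \<and> a - b \<in> R)"

lemma is_subring_subfield: "is_subfield S \<Longrightarrow> is_subring S"
  by (auto simp: is_subring_def intro: subfield_intros)

lemma is_subringD:
  assumes "is_subring R"
  shows subring_zero: "0 \<in> R" and subring_one: "1 \<in> R"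
    and subring_add: "\<And>a b. a \<in> R \<Longrightarrow> b \<in> R \<Longrightarrow> a + b \<in> R"
    and subring_mult: "\<And>a b. a \<in> R \<Longrightarrow> b \<in> R \<Longrightarrow> a * b \<in> R"
    and subring_diff: "\<And>a b. a \<in> R \<Longrightarrow> b \<in> R \<Longrightarrow> a - b \<in> R"
  using assms by (auto simp: is_subring_def)

lemma subring_sum: "is_subring R \<Longrightarrow> (\<And>i. i \<in> I \<Longrightarrow> f i \<in> R) \<Longrightarrow> sum f I \<in> R"
  by (induction I rule: infinite_finite_induct) (auto intro: subring_zero subring_add)

lemma subring_of_nat: "is_subring S \<Longrightarrow> of_nat n \<in> S"
  by (induction n) (auto intro: subring_zero subring_one subring_add)

lemma subring_power: "is_subring S \<Longrightarrow> a \<in> S \<Longrightarrow> a ^ n \<in> S"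
  by (induction n) (auto intro: subring_one subring_mult)

text \<open>Membership is stated as \<open>b * u \<in> R\<close> so that no quotients have to be
  manipulated. For nonzero \<open>u\<close> with denominator \<open>b\<close>, the inverse has
  denominator \<open>b * u\<close> and numerator \<open>b\<close>.\<close>

lemma is_subfield_fractions:
  assumes R: "is_subring R"
  shows "is_subfield {u. \<exists>b\<in>R. b \<noteq> 0 \<and> b * u \<in> R}" (is "is_subfield ?S")
proof -
  have 1: "u + v \<in> ?S" "u * v \<in> ?S" if "u \<in> ?S" "v \<in> ?S" for u v
  proof -
    from that obtain b d where bd: "b \<in> R" "d \<in> R" "b \<noteq> 0" "d \<noteq> 0" "b * u \<in> R" "d * v \<in> R" by auto
    have "(b * d) * (u + v) = d * (b * u) + b * (d * v)" "(b * d) * (u * v) = (b * u) * (d * v)"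
      by (simp_all add: algebra_simps)
    then have *: "(b * d) * (u + v) \<in> R" "(b * d) * (u * v) \<in> R" "b * d \<in> R" "b * d \<noteq> 0"
      using bd subring_add[OF R] subring_mult[OF R] by (metis, metis, auto)
    show "u + v \<in> ?S" "u * v \<in> ?S" using * by blast+
  qed
  have 2: "- u \<in> ?S" "inverse u \<in> ?S" if u: "u \<in> ?S" for u
  proof -
    from u obtain b where b: "b \<in> R" "b \<noteq> 0" "b * u \<in> R" by auto
    have "b * (- u) \<in> R" using subring_diff[OF R subring_zero[OF R] b(3)] by simp
    then show "- u \<in> ?S" using b by blast
    show "inverse u \<in> ?S"
    proof (cases "u = 0")
      case False
      then have "(b * u) * inverse u = b" "b * u \<noteq> 0" using b by simp_all
      then show ?thesis using b(1,3) by (intro CollectI bexI[of _ "b * u"]) metis+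
    qed (use u in simp)
  qed
  have 3: "0 \<in> ?S" "1 \<in> ?S"
    using subring_zero[OF R] subring_one[OF R] by (auto intro!: bexI[of _ 1])
  show ?thesis by (rule is_subfieldI) (fact 1 2 3)+
qed

text \<open>Fields are subsets of one ambient type here, so polynomials over a subfield are ambient
  polynomials with restricted coefficients.\<close>

definition poly_over :: "'a::comm_ring_1 set \<Rightarrow> 'a poly set" where
  "poly_over E = {P. \<forall>i. coeff P i \<in> E}"

lemma poly_overI: "(\<And>i. coeff P i \<in> E) \<Longrightarrow> P \<in> poly_over E"
  and poly_overD: "P \<in> poly_over E \<Longrightarrow> coeff P i \<in> E"
  by (auto simp: poly_over_def)

lemma poly_over_mono: "E \<subseteq> E' \<Longrightarrow> P \<in> poly_over E \<Longrightarrow> P \<in> poly_over E'"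
  by (auto simp: poly_over_def)

context
  fixes R :: "'a::field set"
  assumes R: "is_subring R"
begin

lemma poly_over_0: "0 \<in> poly_over R"
  and poly_over_const: "c \<in> R \<Longrightarrow> [:c:] \<in> poly_over R"
  and poly_over_monom: "c \<in> R \<Longrightarrow> monom c n \<in> poly_over R"
  and poly_over_pCons: "c \<in> R \<Longrightarrow> P \<in> poly_over R \<Longrightarrow> pCons c P \<in> poly_over R"
  and poly_over_add: "P \<in> poly_over R \<Longrightarrow> Q \<in> poly_over R \<Longrightarrow> P + Q \<in> poly_over R"
  and poly_over_diff: "P \<in> poly_over R \<Longrightarrow> Q \<in> poly_over R \<Longrightarrow> P - Q \<in> poly_over R"
  and poly_over_smult: "c \<in> R \<Longrightarrow> P \<in> poly_over R \<Longrightarrow> smult c P \<in> poly_over R"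
  and poly_over_mult: "P \<in> poly_over R \<Longrightarrow> Q \<in> poly_over R \<Longrightarrow> P * Q \<in> poly_over R"
  and poly_over_pderiv: "P \<in> poly_over R \<Longrightarrow> pderiv P \<in> poly_over R"
  by (auto simp: poly_over_def coeff_pCons coeff_mult coeff_pderiv simp del: of_nat_Suc split: nat.split
      intro!: subring_sum[OF R] subring_zero[OF R] subring_one[OF R] subring_add[OF R]
        subring_mult[OF R] subring_diff[OF R] subring_of_nat[OF R])

lemma poly_over_1: "1 \<in> poly_over R"
  using poly_over_const[OF subring_one[OF R]] by (simp add: one_pCons)

lemma poly_over_power: "P \<in> poly_over R \<Longrightarrow> P ^ n \<in> poly_over R"
  by (induction n) (auto intro: poly_over_1 poly_over_mult)

lemma poly_over_sum: "(\<And>i. i \<in> I \<Longrightarrow> f i \<in> poly_over R) \<Longrightarrow> sum f I \<in> poly_over R"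
  by (induction I rule: infinite_finite_induct) (auto intro: poly_over_0 poly_over_add)

lemma poly_in_subring: "P \<in> poly_over R \<Longrightarrow> t \<in> R \<Longrightarrow> poly P t \<in> R"
  by (auto simp: poly_altdef poly_over_def intro!: subring_sum[OF R] subring_mult[OF R] subring_power[OF R])

end

lemmas poly_over_intros = poly_over_0 poly_over_1 poly_over_const poly_over_monom poly_over_pCons
  poly_over_add poly_over_diff poly_over_smult poly_over_mult poly_over_pderiv poly_over_power
  poly_over_sum

section \<open>Rings and fields generated by one element\<close>

definition ring_adjoin :: "'a::field set \<Rightarrow> 'a \<Rightarrow> 'a set" where
  "ring_adjoin R t = (\<lambda>P. poly P t) ` poly_over R"

lemma ring_adjoinI: "P \<in> poly_over R \<Longrightarrow> poly P t \<in> ring_adjoin R t"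
  by (auto simp: ring_adjoin_def)

lemma ring_adjoinE:
  assumes "u \<in> ring_adjoin R t"
  obtains P where "P \<in> poly_over R" "u = poly P t"
  using assms by (auto simp: ring_adjoin_def)

lemma is_subring_ring_adjoin:
  assumes "is_subring R"
  shows "is_subring (ring_adjoin R t)"
  unfolding is_subring_def
proof (intro conjI ballI)
  show "0 \<in> ring_adjoin R t" using ring_adjoinI[OF poly_over_0[OF assms], of t] by simp
  show "1 \<in> ring_adjoin R t" using ring_adjoinI[OF poly_over_1[OF assms], of t] by simp
next
  fix a b assume "a \<in> ring_adjoin R t" "b \<in> ring_adjoin R t"
  then obtain P Q where "P \<in> poly_over R" "a = poly P t" "Q \<in> poly_over R" "b = poly Q t"
    by (auto elim!: ring_adjoinE)
  then show "a + b \<in> ring_adjoin R t" "a * b \<in> ring_adjoin R t" "a - b \<in> ring_adjoin R t"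
    by (simp_all flip: poly_add poly_mult poly_diff add: ring_adjoinI poly_over_intros[OF assms])
qed

lemma base_in_ring_adjoin: "is_subring R \<Longrightarrow> a \<in> R \<Longrightarrow> a \<in> ring_adjoin R t"
  using ring_adjoinI[OF poly_over_const, of R a t] by simp

lemma gen_in_ring_adjoin: "is_subring R \<Longrightarrow> t \<in> ring_adjoin R t"
  using ring_adjoinI[of "[:0, 1:]" R t]
  by (simp add: poly_over_intros subring_zero subring_one)

lemma field_gen_fraction:
  assumes R: "is_subring R" and A: "A \<subseteq> R" and u: "u \<in> field_gen A"
  obtains b where "b \<in> R" "b \<noteq> 0" "b * u \<in> R"
proof -
  have "R \<subseteq> {u. \<exists>b\<in>R. b \<noteq> 0 \<and> b * u \<in> R}"
    using subring_one[OF R] by (auto intro!: bexI[of _ 1])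
  then have "field_gen A \<subseteq> {u. \<exists>b\<in>R. b \<noteq> 0 \<and> b * u \<in> R}"
    using A by (intro field_gen_least is_subfield_fractions[OF R]) auto
  then show ?thesis using u that by blast
qed

lemma field_gen_adjoin_fraction:
  assumes E: "is_subfield E" and u: "u \<in> field_gen (insert t E)"
  obtains P Q where "P \<in> poly_over E" "Q \<in> poly_over E" "poly Q t \<noteq> 0" "poly Q t * u = poly P t"
proof -
  note R = is_subring_subfield[OF E]
  have "insert t E \<subseteq> ring_adjoin E t"
    using base_in_ring_adjoin[OF R] gen_in_ring_adjoin[OF R] by auto
  from field_gen_fraction[OF is_subring_ring_adjoin[OF R] this u]
  obtain b where b: "b \<in> ring_adjoin E t" "b \<noteq> 0" "b * u \<in> ring_adjoin E t" .
  from b(1) obtain Q where Q: "Q \<in> poly_over E" "b = poly Q t" by (rule ring_adjoinE)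
  from b(3) obtain P where P: "P \<in> poly_over E" "b * u = poly P t" by (rule ring_adjoinE)
  show ?thesis using that[OF P(1) Q(1)] P(2) Q(2) b(2) by simp
qed

lemma transcendental_over_iff:
  assumes "is_subring E"
  shows "transcendental_over E t \<longleftrightarrow> (\<forall>P\<in>poly_over E. poly P t = 0 \<longrightarrow> P = 0)"
proof (intro iffI ballI impI)
  fix P assume *: "transcendental_over E t" "P \<in> poly_over E" "poly P t = 0"
  have "(\<forall>i\<le>degree P. coeff P i \<in> E) \<and> (\<Sum>i\<le>degree P. coeff P i * t ^ i) = 0"
    using *(2) *(3)[unfolded poly_altdef] by (simp add: poly_over_def)
  with *(1)[unfolded transcendental_over_def, THEN spec, of "coeff P", THEN spec, of "degree P"]
  have "\<forall>i\<le>degree P. coeff P i = 0" by (rule mp)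
  then have "lead_coeff P = 0" by simp
  then show "P = 0" by simp
next
  assume *: "\<forall>P\<in>poly_over E. poly P t = 0 \<longrightarrow> P = 0"
  show "transcendental_over E t"
    unfolding transcendental_over_def
  proof (intro allI impI, elim conjE)
    fix c :: "nat \<Rightarrow> 'a" and n i
    assume c: "\<forall>i\<le>n. c i \<in> E" and s: "(\<Sum>i\<le>n. c i * t ^ i) = 0" and i: "i \<le> n"
    define P where "P = (\<Sum>i\<le>n. monom (c i) i)"
    have "P \<in> poly_over E"
      unfolding P_def using c by (intro poly_over_sum[OF assms] poly_over_monom[OF assms]) auto
    moreover have "poly P t = 0" using s by (simp add: P_def poly_sum poly_monom)
    ultimately have "P = 0" using * by blast
    moreover have "coeff P i = c i" using i by (simp add: P_def coeff_sum)
    ultimately show "c i = 0" by simp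
  qed
qed

text \<open>Comparison of coefficients: this is how differential equations in E(t) become equations
  for the coefficients.\<close>

lemma transcendental_poly_eq:
  assumes E: "is_subring E" and t: "transcendental_over E t"
    and "P \<in> poly_over E" "Q \<in> poly_over E" "poly P t = poly Q t"
  shows "P = Q"
  using transcendental_over_iff[OF E] t assms(3-5) poly_over_diff[OF E, of P Q]
  by (metis eq_iff_diff_eq_0 poly_diff)

lemma transcendental_notin:
  assumes E: "is_subring E" and t: "transcendental_over E t"
  shows "t \<notin> E"
proof
  assume "t \<in> E"
  then have "[:t:] = [:0, 1:]"
    by (intro transcendental_poly_eq[OF E t]) (auto intro: poly_over_intros[OF E] subring_one[OF E] subring_zero[OF E])
  then show False by simp
qed

lemma transcendental_over_mono: "E \<subseteq> E' \<Longrightarrow> transcendental_over E' t \<Longrightarrow> transcendental_over E t"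
  unfolding transcendental_over_def by blast

text \<open>A nonzero element of least degree is scaled to be monic. Being zero or of lower degree
  is expressed by vanishing coefficients from \<open>degree P\<close> on, which sidesteps the
  convention that 0 has degree 0.\<close>

lemma monic_min_degree:
  assumes E: "is_subfield E" and sub: "I \<subseteq> poly_over E"
    and smult: "\<And>c P. c \<in> E \<Longrightarrow> P \<in> I \<Longrightarrow> smult c P \<in> I"
    and ex: "P0 \<in> I" "P0 \<noteq> 0"
  obtains P where "P \<in> I" "lead_coeff P = 1"
    "\<And>Q. Q \<in> I \<Longrightarrow> (\<And>i. i \<ge> degree P \<Longrightarrow> coeff Q i = 0) \<Longrightarrow> Q = 0"
proof -
  obtain P where P: "P \<in> I" "P \<noteq> 0" and min: "\<And>Q. Q \<in> I \<Longrightarrow> Q \<noteq> 0 \<Longrightarrow> degree P \<le> degree Q"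
    using ex exists_least_lemma[of "\<lambda>n. \<exists>P\<in>I. P \<noteq> 0 \<and> degree P = n"]
    by (metis (mono_tags, lifting) arg_min_nat_lemma[of "\<lambda>P. P \<in> I \<and> P \<noteq> 0" P0 degree])
  let ?P = "smult (inverse (lead_coeff P)) P"
  show ?thesis
  proof
    show "?P \<in> I"
      using P sub E by (intro smult) (auto simp: poly_over_def intro: subfield_inverse)
    show "lead_coeff ?P = 1" using P by simp
    fix Q assume Q: "Q \<in> I" and z: "\<And>i. i \<ge> degree ?P \<Longrightarrow> coeff Q i = 0"
    show "Q = 0"
    proof (rule ccontr)
      assume "Q \<noteq> 0"
      then have "coeff Q (degree Q) = 0" using min[OF Q] P by (intro z) auto
      with \<open>Q \<noteq> 0\<close> show False by simp
    qed
  qed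
qed

section \<open>Derivations\<close>

context
  fixes D :: "'a::field_char_0 \<Rightarrow> 'a"
  assumes D: "is_derivation D"
begin

lemma der_add: "D (a + b) = D a + D b" and der_mult: "D (a * b) = a * D b + D a * b"
  using D by (auto simp: is_derivation_def)

lemma der_0 [simp]: "D 0 = 0" using der_add[of 0 0] by simp
lemma der_1 [simp]: "D 1 = 0" using der_mult[of 1 1] by simp
lemma der_minus: "D (- a) = - D a" using der_add[of a "- a"] by (simp add: eq_neg_iff_add_eq_0 add.commute)
lemma der_diff: "D (a - b) = D a - D b" using der_add[of a "- b"] by (simp add: der_minus)
lemma der_sum: "D (sum f I) = (\<Sum>i\<in>I. D (f i))"
  by (induction I rule: infinite_finite_induct) (auto simp: der_add)
lemma der_of_nat [simp]: "D (of_nat n) = 0"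
  by (induction n) (auto simp: der_add)

lemma der_inverse: "D (inverse a) = - D a * inverse a * inverse a"
proof (cases "a = 0")
  case False
  have "a * D (inverse a) + D a * inverse a = 0"
    using der_mult[of a "inverse a"] False by simp
  then have "a * D (inverse a) = - (D a * inverse a)" by (simp add: eq_neg_iff_add_eq_0)
  then show ?thesis using False by (simp add: field_simps)
qed simp

lemma der_divide: "b \<noteq> 0 \<Longrightarrow> D (a / b) = (D a * b - a * D b) / (b * b)"
  by (simp add: divide_inverse der_mult der_inverse) (simp add: field_simps)

text \<open>The extra factor \<open>a\<close> avoids the exponent \<open>n - 1\<close>, so
  \<open>n = 0\<close> and \<open>a = 0\<close> need no separate treatment.\<close>

lemma der_power: "D (a ^ n) * a = of_nat n * D a * a ^ n"
proof (induction n)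
  case (Suc n)
  have "D (a ^ Suc n) * a = a * (D (a ^ n) * a) + D a * a ^ Suc n"
    by (simp add: der_mult algebra_simps)
  also have "\<dots> = of_nat (Suc n) * D a * a ^ Suc n"
    unfolding Suc.IH by (simp add: algebra_simps)
  finally show ?case .
qed simp

lemma der_exp_power: "D a = p * a \<Longrightarrow> D (a ^ n) = of_nat n * p * a ^ n"
  by (induction n) (auto simp: der_mult algebra_simps)

lemma der_exp_quotient:
  assumes "D a = p * a" "D b = p * b"
  shows "D (a / b) = 0"
  using der_divide[of b a] assms by (cases "b = 0") auto

text \<open>The elements of \<open>T\<close> with derivative in \<open>T\<close> form a subfield.
  \<open>T\<close> may exceed the generated field, as happens when \<open>dp\<close> leads from one
  field of a tower into the next.\<close>

lemma der_field_gen: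
  assumes T: "is_subfield T" and A: "A \<subseteq> T" "D ` A \<subseteq> T"
  shows "D ` field_gen A \<subseteq> T"
proof -
  have "is_subfield {u \<in> T. D u \<in> T}"
    using T unfolding is_subfield_def by (auto simp: der_add der_mult der_minus der_inverse)
  then have "field_gen A \<subseteq> {u \<in> T. D u \<in> T}"
    using A by (intro field_gen_least) auto
  then show ?thesis by auto
qed

lemma der_field_gen_stable: "D ` A \<subseteq> field_gen A \<Longrightarrow> D ` field_gen A \<subseteq> field_gen A"
  by (intro der_field_gen is_subfield_field_gen subset_field_gen)

text \<open>The action of \<open>D\<close> on polynomials in \<open>t\<close>, where \<open>D t = \<alpha> + \<beta> t\<close>.\<close>

definition ext_der :: "'a \<Rightarrow> 'a \<Rightarrow> 'a poly \<Rightarrow> 'a poly" where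
  "ext_der \<alpha> \<beta> P = map_poly D P + [:\<alpha>, \<beta>:] * pderiv P"

lemma coeff_ext_der:
  "coeff (ext_der \<alpha> \<beta> P) i = D (coeff P i) + \<alpha> * of_nat (Suc i) * coeff P (Suc i) + \<beta> * of_nat i * coeff P i"
  by (cases i) (simp_all add: ext_der_def coeff_map_poly coeff_pderiv coeff_pCons mult.assoc del: of_nat_Suc)

lemma poly_ext_der: "D t = \<alpha> + \<beta> * t \<Longrightarrow> poly (ext_der \<alpha> \<beta> P) t = D (poly P t)"
  by (induction P)
    (auto simp: ext_der_def map_poly_pCons pderiv_pCons der_add der_mult algebra_simps)

lemma poly_over_ext_der:
  assumes E: "is_subfield E" "D ` E \<subseteq> E" and "\<alpha> \<in> E" "\<beta> \<in> E" "P \<in> poly_over E"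
  shows "ext_der \<alpha> \<beta> P \<in> poly_over E"
  using assms by (intro poly_overI) (auto simp: coeff_ext_der poly_over_def simp del: of_nat_Suc
    intro!: subfield_intros[OF E(1)])

end

section \<open>Primitives and exponentials without new constants\<close>

text \<open>To be used with \<delta> for \<open>D\<close> and the PPV extension for
  \<open>M\<close>; \<open>const_in_K\<close> says that \<open>M\<close> has no constants beyond
  those of \<open>K\<close>.\<close>

locale no_new_constants =
  fixes D :: "'a::field_char_0 \<Rightarrow> 'a" and M K :: "'a set"
  assumes D: "is_derivation D"
    and M: "is_subfield M" and M_stable: "D ` M \<subseteq> M"
    and K: "is_subfield K" and K_stable: "D ` K \<subseteq> K" and K_M: "K \<subseteq> M"
    and const_in_K: "\<And>u. u \<in> M \<Longrightarrow> D u = 0 \<Longrightarrow> u \<in> K"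
begin

definition interm :: "'a set \<Rightarrow> bool" where
  "interm E \<longleftrightarrow> is_subfield E \<and> K \<subseteq> E \<and> E \<subseteq> M \<and> D ` E \<subseteq> E"

lemma intermD:
  assumes "interm E"
  shows interm_subfield: "is_subfield E" and interm_subring: "is_subring E"
    and interm_K: "K \<subseteq> E" and interm_M: "E \<subseteq> M"
    and interm_stable: "D ` E \<subseteq> E"
  using assms is_subring_subfield by (auto simp: interm_def)

lemma interm_K_self: "interm K"
  using K K_M K_stable by (auto simp: interm_def)

lemma interm_field_gen:
  assumes E: "interm E" and A: "A \<subseteq> M" "D ` A \<subseteq> field_gen (E \<union> A)"
  shows "interm (field_gen (E \<union> A))"
  unfolding interm_def
proof (intro conjI)
  show "K \<subseteq> field_gen (E \<union> A)" using interm_K[OF E] subset_field_gen[of "E \<union> A"] by auto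
  show "field_gen (E \<union> A) \<subseteq> M" using interm_M[OF E] A by (intro field_gen_least M) auto
  show "D ` field_gen (E \<union> A) \<subseteq> field_gen (E \<union> A)"
    using interm_stable[OF E] A(2) subset_field_gen[of "E \<union> A"]
    by (intro der_field_gen_stable[OF D]) auto
qed (rule is_subfield_field_gen)

lemma interm_adjoin:
  assumes E: "interm E" and t: "t \<in> M" "D t \<in> field_gen (insert t E)"
  shows "interm (field_gen (insert t E))"
  using interm_field_gen[OF E, of "{t}"] t by simp

lemma const_in_interm: "interm E \<Longrightarrow> u \<in> M \<Longrightarrow> D u = 0 \<Longrightarrow> u \<in> E"
  using const_in_K interm_K by blast

text \<open>For monic P of degree d, the derivation does not raise the degree and produces top
  coefficient d \<beta>, which the subtracted multiple of P cancels.\<close>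

lemma ext_der_same_degree:
  assumes "lead_coeff P = 1" "i \<ge> degree P"
  shows "coeff (ext_der D \<alpha> \<beta> P - smult (of_nat (degree P) * \<beta>) P) i = 0"
  using assms by (cases "i = degree P") (auto simp: coeff_ext_der[OF D] coeff_eq_0 der_0[OF D] der_1[OF D])

context
  fixes E :: "'a set" and t \<alpha> \<beta> :: 'a
  assumes E: "interm E" and \<alpha>: "\<alpha> \<in> E" and \<beta>: "\<beta> \<in> E" and Dt: "D t = \<alpha> + \<beta> * t"
begin

text \<open>By the cancellation of top terms, the difference of the two sides of the equation for
  \<open>P\<close> lies in \<open>I\<close> below the least degree, hence vanishes. \<open>I\<close>
  will be an ideal of relations or of denominators.\<close>

lemma monic_der_relation:
  assumes sub: "I \<subseteq> poly_over E"
    and smult: "\<And>c P. c \<in> E \<Longrightarrow> P \<in> I \<Longrightarrow> smult c P \<in> I"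
    and diff: "\<And>P Q. P \<in> I \<Longrightarrow> Q \<in> I \<Longrightarrow> P - Q \<in> I"
    and der: "\<And>P. P \<in> I \<Longrightarrow> ext_der D \<alpha> \<beta> P \<in> I"
    and ex: "P0 \<in> I" "P0 \<noteq> 0"
  obtains P where "P \<in> I" "lead_coeff P = 1" "ext_der D \<alpha> \<beta> P = smult (of_nat (degree P) * \<beta>) P"
    "\<And>Q. Q \<in> I \<Longrightarrow> (\<And>i. i \<ge> degree P \<Longrightarrow> coeff Q i = 0) \<Longrightarrow> Q = 0"
proof -
  obtain P where P: "P \<in> I" "lead_coeff P = 1"
    and min: "\<And>Q. Q \<in> I \<Longrightarrow> (\<And>i. i \<ge> degree P \<Longrightarrow> coeff Q i = 0) \<Longrightarrow> Q = 0"
    using monic_min_degree[OF interm_subfield[OF E] sub smult ex] by blast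
  have "ext_der D \<alpha> \<beta> P - smult (of_nat (degree P) * \<beta>) P = 0"
    using P \<beta> interm_subfield[OF E] ext_der_same_degree[OF P(2)]
    by (intro min diff der smult) (auto intro: subfield_intros)
  then show ?thesis using that P min by simp
qed

text \<open>\<open>P\<close> is the minimal polynomial of \<open>t\<close>: the ideal of relations
  is stable because differentiating P(t) = 0 gives another relation.\<close>

lemma algebraic_relation:
  assumes "\<not> transcendental_over E t"
  obtains P where "P \<in> poly_over E" "poly P t = 0" "lead_coeff P = 1"
    "ext_der D \<alpha> \<beta> P = smult (of_nat (degree P) * \<beta>) P"
    "\<And>Q. Q \<in> poly_over E \<Longrightarrow> poly Q t = 0 \<Longrightarrow> (\<And>i. i \<ge> degree P \<Longrightarrow> coeff Q i = 0) \<Longrightarrow> Q = 0"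
proof -
  note R = interm_subring[OF E]
  obtain P0 where P0: "P0 \<in> poly_over E" "poly P0 t = 0" "P0 \<noteq> 0"
    using assms transcendental_over_iff[OF R] by blast
  let ?I = "{P \<in> poly_over E. poly P t = 0}"
  have "poly (ext_der D \<alpha> \<beta> P) t = 0" if "P \<in> ?I" for P
    using that poly_ext_der[OF D Dt] der_0[OF D] by simp
  then obtain P where P: "P \<in> ?I" "lead_coeff P = 1" "ext_der D \<alpha> \<beta> P = smult (of_nat (degree P) * \<beta>) P"
    and min: "\<And>Q. Q \<in> ?I \<Longrightarrow> (\<And>i. i \<ge> degree P \<Longrightarrow> coeff Q i = 0) \<Longrightarrow> Q = 0"
    using P0 poly_over_smult[OF R] poly_over_diff[OF R] \<alpha> \<beta>
      poly_over_ext_der[OF D interm_subfield[OF E] interm_stable[OF E]]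
    by (elim monic_der_relation[of ?I P0, rotated -1]) auto
  show ?thesis using P min by (intro that[of P]) auto
qed

text \<open>The denominators of \<open>u\<close> form an ideal that is stable under the derivation, so a monic
  denominator of least degree satisfies a first-order equation.\<close>

lemma minimal_denominator:
  assumes t: "transcendental_over E t" and u: "u \<in> field_gen (insert t E)"
    and q: "q \<in> E" and Du: "D u + q * u \<in> ring_adjoin E t"
  obtains Q where "Q \<in> poly_over E" "lead_coeff Q = 1" "poly Q t * u \<in> ring_adjoin E t"
    "D (poly Q t) = of_nat (degree Q) * \<beta> * poly Q t"
proof -
  note R = interm_subring[OF E]
  note R' = is_subring_ring_adjoin[OF R, of t]
  obtain P0 Q0 where PQ: "P0 \<in> poly_over E" "Q0 \<in> poly_over E" "poly Q0 t \<noteq> 0" "poly Q0 t * u = poly P0 t"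
    using field_gen_adjoin_fraction[OF interm_subfield[OF E] u] by metis
  let ?I = "{Q \<in> poly_over E. poly Q t * u \<in> ring_adjoin E t}"
  have der: "D v \<in> ring_adjoin E t" if v: "v \<in> ring_adjoin E t" for v
  proof -
    from v obtain P where "P \<in> poly_over E" "v = poly P t" by (rule ring_adjoinE)
    then show ?thesis
      using poly_ext_der[OF D Dt, of P]
        ring_adjoinI[OF poly_over_ext_der[OF D interm_subfield[OF E] interm_stable[OF E] \<alpha> \<beta>], of P t]
      by simp
  qed
  have 1: "ext_der D \<alpha> \<beta> Q \<in> ?I" if Q: "Q \<in> ?I" for Q
  proof -
    \<comment> \<open>The product rule with \<open>q * u\<close> added and subtracted, so that the
      hypothesis on \<open>D u + q * u\<close> applies.\<close>
    have "D (poly Q t) * u = D (poly Q t * u) - poly Q t * (D u + q * u) + q * (poly Q t * u)"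
      by (simp add: der_mult[OF D] algebra_simps)
    also have "\<dots> \<in> ring_adjoin E t"
      using Q Du der base_in_ring_adjoin[OF R q]
      by (auto intro!: subring_add[OF R'] subring_diff[OF R'] subring_mult[OF R'] ring_adjoinI)
    finally show ?thesis
      using Q poly_ext_der[OF D Dt, of Q]
        poly_over_ext_der[OF D interm_subfield[OF E] interm_stable[OF E] \<alpha> \<beta>, of Q] by simp
  qed
  have 2: "smult c Q \<in> ?I" if "c \<in> E" "Q \<in> ?I" for c Q
    using that base_in_ring_adjoin[OF R] subring_mult[OF R', of c "poly Q t * u"]
    by (simp add: poly_over_smult[OF R] mult.assoc)
  have 3: "P - Q \<in> ?I" if "P \<in> ?I" "Q \<in> ?I" for P Q
    using that subring_diff[OF R'] by (simp add: poly_over_diff[OF R] left_diff_distrib)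
  have 4: "Q0 \<in> ?I" "Q0 \<noteq> 0" using PQ ring_adjoinI[OF PQ(1)] by auto
  obtain Q where Q: "Q \<in> ?I" "lead_coeff Q = 1" "ext_der D \<alpha> \<beta> Q = smult (of_nat (degree Q) * \<beta>) Q"
    using monic_der_relation[OF _ 2 3 1 4] by blast
  show ?thesis
    using Q poly_ext_der[OF D Dt, of Q] by (intro that[of Q]) auto
qed

end

text \<open>If the minimal polynomial is t^(n+1) + a t^n + ..., its differential equation in degree
  n says that a + (n + 1) t is constant. It then lies in \<open>E\<close>, and so does
  \<open>t\<close> in characteristic zero.\<close>

lemma primitive_algebraic:
  assumes E: "interm E" and t: "t \<in> M" "D t \<in> E" and alg: "\<not> transcendental_over E t"
  shows "t \<in> E"
proof -
  obtain P where P: "P \<in> poly_over E" "poly P t = 0" "lead_coeff P = 1" "ext_der D (D t) 0 P = 0"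
    using algebraic_relation[OF E t(2) subfield_zero[OF interm_subfield[OF E]] _ alg] by auto
  have "degree P \<noteq> 0"
  proof
    assume "degree P = 0"
    then obtain c where "P = [:c:]" by (metis degree_eq_zeroE)
    then show False using P by simp
  qed
  then obtain n where n: "degree P = Suc n" by (cases "degree P") auto
  let ?c = "coeff P n + of_nat (Suc n) * t"
  have "D ?c = coeff (ext_der D (D t) 0 P) n"
    using P(3) n by (simp add: coeff_ext_der[OF D] der_add[OF D] der_mult[OF D] der_of_nat[OF D] der_1[OF D] algebra_simps)
  then have "?c \<in> E"
    using P(1,4) t interm_M[OF E] M
    by (intro const_in_interm[OF E]) (auto simp: poly_over_def simp del: of_nat_Suc intro!: subfield_intros)
  then have "?c - coeff P n \<in> E"
    by (rule subfield_diff[OF interm_subfield[OF E] _ poly_overD[OF P(1)]])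
  then have "of_nat (Suc n) * t \<in> E" by (simp only: add_diff_cancel_left')
  then show ?thesis
    by (rule subfield_mult_cancel[OF interm_subfield[OF E] subfield_of_nat[OF interm_subfield[OF E]], rotated])
      (simp del: of_nat_Suc)
qed

text \<open>The constant term a of the minimal polynomial of degree d satisfies the same equation as
  t^d, so a / t^d is constant. It is nonzero, since otherwise a factor \<open>t\<close> could be
  cancelled from the minimal relation.\<close>

lemma exponential_algebraic:
  assumes E: "interm E" and t: "t \<in> M" "D t = p * t" "t \<noteq> 0" and p: "p \<in> E"
    and alg: "\<not> transcendental_over E t"
  obtains k where "k > 0" "t ^ k \<in> E"
proof -
  note F = interm_subfield[OF E]
  obtain P where P: "P \<in> poly_over E" "poly P t = 0" "lead_coeff P = 1"
    "ext_der D 0 p P = smult (of_nat (degree P) * p) P"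
    and min: "\<And>Q. Q \<in> poly_over E \<Longrightarrow> poly Q t = 0 \<Longrightarrow> (\<And>i. i \<ge> degree P \<Longrightarrow> coeff Q i = 0) \<Longrightarrow> Q = 0"
    using algebraic_relation[OF E subfield_zero[OF F] p _ alg] t(2) by (metis add_0)
  let ?d = "degree P" and ?a = "coeff P 0"
  have "?d \<noteq> 0"
  proof
    assume "?d = 0"
    then obtain c where "P = [:c:]" by (metis degree_eq_zeroE)
    then show False using P by simp
  qed
  have "?a \<noteq> 0"
  proof
    assume "?a = 0"
    obtain a Q where Q: "P = pCons a Q" by (cases P)
    with \<open>?a = 0\<close> have "P = pCons 0 Q" by simp
    moreover have "Q \<in> poly_over E"
      using poly_overD[OF P(1), of "Suc _"] Q by (intro poly_overI) simp
    moreover have "poly Q t = 0" using P(2) t(3) \<open>P = pCons 0 Q\<close> by simp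
    moreover have "coeff Q i = 0" if "i \<ge> ?d" for i
      using that \<open>P = pCons 0 Q\<close> coeff_eq_0[of P "Suc i"] by simp
    ultimately have "Q = 0" using min by blast
    with \<open>P = pCons 0 Q\<close> P(3) show False by simp
  qed
  have "D ?a = coeff (ext_der D 0 p P) 0" by (simp add: coeff_ext_der[OF D])
  also have "\<dots> = (of_nat ?d * p) * ?a" by (simp add: P(4))
  finally have "D (?a / t ^ ?d) = 0"
    using der_exp_power[OF D t(2), of ?d] by (rule der_exp_quotient[OF D])
  then have c: "?a / t ^ ?d \<in> E"
    using P(1) t(1) interm_M[OF E] M
    by (intro const_in_interm[OF E]) (auto simp: poly_over_def intro!: subfield_intros)
  have "t ^ ?d = ?a / (?a / t ^ ?d)" using \<open>?a \<noteq> 0\<close> by simp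
  also have "\<dots> \<in> E" by (intro subfield_divide[OF F] poly_overD[OF P(1)] c)
  finally show ?thesis using that \<open>?d \<noteq> 0\<close> by blast
qed

text \<open>With \<beta> = 0 the minimal denominator takes a constant value at \<open>t\<close>.
  This value lies in \<open>E\<close>, so by transcendence the monic denominator is 1.\<close>

lemma adjoin_primitive_denominator_free:
  assumes E: "interm E" and t: "t \<in> M" "D t \<in> E" "transcendental_over E t"
    and u: "u \<in> field_gen (insert t E)" and q: "q \<in> E" and Du: "D u + q * u \<in> ring_adjoin E t"
  shows "u \<in> ring_adjoin E t"
proof -
  note F = interm_subfield[OF E]
  note R = interm_subring[OF E]
  have "D t = D t + 0 * t" by simp
  from minimal_denominator[OF E t(2) subfield_zero[OF F] this t(3) u q Du]
  obtain Q where Q: "Q \<in> poly_over E" "lead_coeff Q = 1" "poly Q t * u \<in> ring_adjoin E t"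
    "D (poly Q t) = of_nat (degree Q) * 0 * poly Q t" .
  have "poly Q t \<in> M"
    by (intro poly_in_subring is_subring_subfield M poly_over_mono[OF interm_M[OF E]] Q t)
  then have "poly Q t \<in> E" using const_in_interm[OF E] Q(4) by simp
  then obtain c where c: "c \<in> E" "poly Q t = c" by blast
  then have "Q = [:c:]"
    using Q(1) by (intro transcendental_poly_eq[OF R t(3)] poly_over_const[OF R]) simp_all
  then have "poly Q t = 1" using Q(2) by simp
  then show ?thesis using Q(3) by simp
qed

text \<open>The minimal denominator, of degree d, satisfies the same equation as t^d. Their quotient
  is constant, so the denominator is t^d itself.\<close>

lemma adjoin_exponential_denominator:
  assumes E: "interm E" and t: "t \<in> M" "D t = p * t" "t \<noteq> 0" "transcendental_over E t" and p: "p \<in> E"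
    and u: "u \<in> field_gen (insert t E)" and q: "q \<in> E" and Du: "D u + q * u \<in> ring_adjoin E t"
  obtains d where "t ^ d * u \<in> ring_adjoin E t"
proof -
  note F = interm_subfield[OF E]
  note R = interm_subring[OF E]
  have "D t = 0 + p * t" using t(2) by simp
  from minimal_denominator[OF E subfield_zero[OF F] p this t(4) u q Du]
  obtain Q where Q: "Q \<in> poly_over E" "lead_coeff Q = 1" "poly Q t * u \<in> ring_adjoin E t"
    "D (poly Q t) = of_nat (degree Q) * p * poly Q t" .
  let ?d = "degree Q" and ?c = "poly Q t / t ^ degree Q"
  have "poly Q t \<in> M"
    by (intro poly_in_subring is_subring_subfield M poly_over_mono[OF interm_M[OF E]] Q t)
  then have "?c \<in> E"
    using der_exp_quotient[OF D Q(4) der_exp_power[OF D t(2)]] t(1) M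
    by (intro const_in_interm[OF E]) (auto intro: subfield_intros)
  then obtain c where c: "c \<in> E" "poly Q t = c * t ^ ?d" using t(3) by (metis nonzero_eq_divide_eq power_not_zero)
  then have "Q = monom c ?d"
    using Q(1) by (intro transcendental_poly_eq[OF R t(4)] poly_over_monom[OF R]) (simp_all add: poly_monom)
  then have "coeff Q ?d = coeff (monom c ?d) ?d" by (rule arg_cong)
  then have "poly Q t = t ^ ?d" using Q(2) c(2) by simp
  then show ?thesis using Q(3) that by simp
qed

text \<open>Ostrowski's theorem for one primitive. If \<open>u\<close> were a polynomial in
  \<open>t\<close> of degree n + 2 with leading coefficient b followed by a, then b and a + (n + 2)
  b t would be constant, forcing \<open>t\<close> into \<open>E\<close>. In degree at most one, the
  coefficient of \<open>t\<close> is constant.\<close>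

lemma adjoin_primitive_primitive:
  assumes E: "interm E" and t: "t \<in> M" "D t \<in> E" "transcendental_over E t"
    and u: "u \<in> field_gen (insert t E)" and Du: "D u \<in> E"
  obtains c e where "c \<in> K" "D c = 0" "e \<in> E" "u = c * t + e"
proof -
  note F = interm_subfield[OF E]
  note R = interm_subring[OF E]
  have "u \<in> ring_adjoin E t"
    using base_in_ring_adjoin[OF R Du]
    by (intro adjoin_primitive_denominator_free[OF E t u subfield_zero[OF F]]) simp
  then obtain P where P: "P \<in> poly_over E" "u = poly P t" by (rule ring_adjoinE)
  have "poly (ext_der D (D t) 0 P) t = poly [:D u:] t"
    by (subst poly_ext_der[OF D]) (simp_all add: P)
  then have ext: "ext_der D (D t) 0 P = [:D u:]"
    using P(1) Du t(2) subfield_zero[OF F]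
    by (intro transcendental_poly_eq[OF R t(3)] poly_over_const[OF R]
        poly_over_ext_der[OF D F interm_stable[OF E]])
  have cM: "coeff P i \<in> M" for i using P(1) interm_M[OF E] by (auto simp: poly_over_def)
  have "degree P \<le> 1"
  proof (rule ccontr)
    assume "\<not> degree P \<le> 1"
    then obtain n where n: "degree P = Suc (Suc n)" by (metis One_nat_def not0_implies_Suc not_less_eq_eq le0)
    let ?b = "coeff P (Suc (Suc n))" and ?a = "coeff P (Suc n)"
    have "D ?b = 0"
      using arg_cong[OF ext, of "\<lambda>P. coeff P (Suc (Suc n))"] n
      by (simp add: coeff_ext_der[OF D] coeff_eq_0)
    moreover have "D ?a + D t * of_nat (Suc (Suc n)) * ?b = 0"
      using arg_cong[OF ext, of "\<lambda>P. coeff P (Suc n)"]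
      by (simp add: coeff_ext_der[OF D] del: of_nat_Suc)
    ultimately have "D (?a + of_nat (Suc (Suc n)) * ?b * t) = 0"
      by (simp add: der_add[OF D] der_mult[OF D] der_of_nat[OF D] algebra_simps del: of_nat_Suc)
    then have "?a + of_nat (Suc (Suc n)) * ?b * t \<in> E"
      using t(1) cM M by (intro const_in_interm[OF E]) (auto intro!: subfield_intros simp del: of_nat_Suc)
    then have "?a + of_nat (Suc (Suc n)) * ?b * t - ?a \<in> E"
      using P(1) by (intro subfield_diff[OF F]) (auto simp: poly_over_def)
    then have "(of_nat (Suc (Suc n)) * ?b) * t \<in> E" by (simp only: add_diff_cancel_left')
    moreover have "of_nat (Suc (Suc n)) * ?b \<noteq> 0" "of_nat (Suc (Suc n)) * ?b \<in> E"
      using n P(1) leading_coeff_0_iff[of P] F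
      by (auto simp: poly_over_def simp del: of_nat_Suc intro!: subfield_intros)
    ultimately have "t \<in> E" using subfield_mult_cancel[OF F] by blast
    then show False using transcendental_notin[OF R t(3)] by blast
  qed
  then have deg: "coeff P (Suc (Suc 0)) = 0" "coeff P i = 0" if "i \<ge> 2" for i
    using that by (auto intro: coeff_eq_0)
  have "D (coeff P 1) = 0"
    using arg_cong[OF ext, of "\<lambda>P. coeff P 1"] deg(1)[of 2] by (simp add: coeff_ext_der[OF D])
  moreover have "P = [:coeff P 0, coeff P 1:]"
    using deg(2) by (auto simp: poly_eq_iff coeff_pCons split: nat.split)
  then have "u = coeff P 1 * t + coeff P 0"
    by (metis P(2) add.commute mult.commute mult_zero_right poly_0 poly_pCons add_0_right)
  ultimately show ?thesis
    using that const_in_K cM poly_overD[OF P(1)] by blast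
qed

text \<open>For transcendental \<open>t\<close>, both \<open>v\<close> and its inverse satisfy
  homogeneous equations and are therefore polynomials in \<open>t\<close>; being mutually inverse
  they have degree 0.\<close>

lemma adjoin_primitive_exponential:
  assumes E: "interm E" and t: "t \<in> M" "D t \<in> E"
    and v: "v \<in> field_gen (insert t E)" "v \<noteq> 0" "D v = q * v" and q: "q \<in> E"
  shows "v \<in> E"
proof (cases "transcendental_over E t")
  case True
  note R = interm_subring[OF E]
  have R0: "0 \<in> ring_adjoin E t" by (rule subring_zero[OF is_subring_ring_adjoin[OF R]])
  have "v \<in> ring_adjoin E t"
    using v R0 subfield_uminus[OF interm_subfield[OF E] q]
    by (intro adjoin_primitive_denominator_free[OF E t True, of v "- q"]) auto
  moreover have "D (inverse v) + q * inverse v = 0"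
    using v by (simp add: der_inverse[OF D])
  then have "inverse v \<in> ring_adjoin E t"
    using v R0 q by (intro adjoin_primitive_denominator_free[OF E t True, of "inverse v" q])
      (auto intro: subfield_inverse[OF is_subfield_field_gen])
  ultimately obtain P Q where PQ: "P \<in> poly_over E" "v = poly P t" "Q \<in> poly_over E" "inverse v = poly Q t"
    by (metis ring_adjoinE)
  have "poly (P * Q) t = poly 1 t" using PQ(2,4) v(2) by (metis poly_1 poly_mult right_inverse)
  then have "P * Q = 1"
    using PQ by (intro transcendental_poly_eq[OF R True] poly_over_mult[OF R] poly_over_1[OF R])
  then have "degree P + degree Q = 0" by (metis degree_1 degree_mult_eq mult_eq_0_iff zero_neq_one)
  then obtain c where "P = [:c:]" by (metis add_is_0 degree_eq_zeroE)
  then show ?thesis using poly_overD[OF PQ(1), of 0] PQ(2) by simp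
next
  case False
  then show ?thesis
    using primitive_algebraic[OF E t] v(1) field_gen_eq[OF interm_subfield[OF E]] by (simp add: insert_absorb)
qed

text \<open>For transcendental \<open>t\<close>, \<open>b\<close> is a polynomial in
  \<open>t\<close>; in positive degree its leading coefficient would solve the homogeneous equation,
  which \<open>hom\<close> excludes.\<close>

lemma adjoin_primitive_inhomogeneous:
  assumes E: "interm E" and t: "t \<in> M" "D t \<in> E"
    and b: "b \<in> field_gen (insert t E)" "D b + q * b \<in> E" and q: "q \<in> E"
    and hom: "\<And>e. e \<in> E \<Longrightarrow> D e + q * e = 0 \<Longrightarrow> e = 0"
  shows "b \<in> E"
proof (cases "transcendental_over E t")
  case True
  note R = interm_subring[OF E]
  note F = interm_subfield[OF E]
  have "b \<in> ring_adjoin E t"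
    using b q base_in_ring_adjoin[OF R] by (intro adjoin_primitive_denominator_free[OF E t True, of b q])
  then obtain P where P: "P \<in> poly_over E" "b = poly P t" by (rule ring_adjoinE)
  have "poly (ext_der D (D t) 0 P + smult q P) t = poly [:D b + q * b:] t"
    by (simp, subst poly_ext_der[OF D]) (simp_all add: P)
  then have ext: "ext_der D (D t) 0 P + smult q P = [:D b + q * b:]"
    using P(1) b t(2) q subfield_zero[OF F]
    by (intro transcendental_poly_eq[OF R True] poly_over_const[OF R] poly_over_add[OF R] poly_over_smult[OF R]
        poly_over_ext_der[OF D F interm_stable[OF E]])
  have "degree P = 0"
  proof (rule ccontr)
    assume n: "degree P \<noteq> 0"
    then have "D (lead_coeff P) + q * lead_coeff P = 0"
      using arg_cong[OF ext, of "\<lambda>Q. coeff Q (degree P)"]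
      by (simp add: coeff_ext_der[OF D] coeff_eq_0 coeff_pCons split: nat.splits)
    then have "lead_coeff P = 0" by (rule hom[OF poly_overD[OF P(1)]])
    then show False using n by simp
  qed
  then obtain c where "P = [:c:]" by (metis degree_eq_zeroE)
  then show ?thesis using poly_overD[OF P(1), of 0] P(2) by simp
next
  case False
  then show ?thesis
    using primitive_algebraic[OF E t] b(1) field_gen_eq[OF interm_subfield[OF E]] by (simp add: insert_absorb)
qed

section \<open>Adjoining finitely many primitives\<close>

lemma interm_adjoin_primitives:
  assumes E: "interm E" and T: "T \<subseteq> M" "D ` T \<subseteq> E"
  shows "interm (field_gen (E \<union> T))"
  using T subset_field_gen[of "E \<union> T"] by (intro interm_field_gen[OF E]) auto

text \<open>Descends from E(T) to \<open>E\<close> by removing one generator at a time. The bound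
  \<open>S \<subseteq> field_gen (E \<union> T)\<close> keeps assumptions about all of E(T)
  available in each step.\<close>

lemma adjoin_primitives_induct [consumes 4, case_names step]:
  assumes E: "interm E" and T: "finite T" "T \<subseteq> M" "D ` T \<subseteq> E"
    and step: "\<And>S t u. \<lbrakk>interm S; E \<subseteq> S; S \<subseteq> field_gen (E \<union> T); t \<in> M; D t \<in> E;
      u \<in> field_gen (insert t S); P u\<rbrakk> \<Longrightarrow> u \<in> S"
    and u: "u \<in> field_gen (E \<union> T)" "P u"
  shows "u \<in> E"
  using T step u
proof (induction T rule: finite_induct)
  case empty
  then show ?case using field_gen_eq[OF interm_subfield[OF E]] by simp
next
  case (insert t T)
  let ?S = "field_gen (E \<union> T)"
  have S: "interm ?S" using insert.prems by (intro interm_adjoin_primitives[OF E]) auto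
  have mono: "?S \<subseteq> field_gen (E \<union> insert t T)" by (rule field_gen_mono) auto
  have eq: "field_gen (E \<union> insert t T) = field_gen (insert t ?S)"
    using field_gen_insert_eq[of "E \<union> T" "{t}"] by simp
  have "u \<in> ?S"
    using insert.prems eq mono subset_field_gen[of "E \<union> T"]
    by (intro insert.prems(3)[of ?S t u] S) auto
  moreover have "\<And>S t u. \<lbrakk>interm S; E \<subseteq> S; S \<subseteq> ?S; t \<in> M; D t \<in> E;
      u \<in> field_gen (insert t S); P u\<rbrakk> \<Longrightarrow> u \<in> S"
    using mono insert.prems(3) by blast
  ultimately show ?case using insert.IH insert.prems by auto
qed

lemma adjoin_primitives_exponential:
  assumes E: "interm E" and T: "finite T" "T \<subseteq> M" "D ` T \<subseteq> E"
    and v: "v \<in> field_gen (E \<union> T)" "v \<noteq> 0" "D v = q * v" and q: "q \<in> E"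
  shows "v \<in> E"
  using E T
proof (rule adjoin_primitives_induct[where P = "\<lambda>v. v \<noteq> 0 \<and> D v = q * v"])
  fix S t u assume *: "interm S" "E \<subseteq> S" "t \<in> M" "D t \<in> E" "u \<in> field_gen (insert t S)" "u \<noteq> 0 \<and> D u = q * u"
  then show "u \<in> S" using q by (intro adjoin_primitive_exponential[of S t u q]) auto
qed (use v in auto)

lemma adjoin_primitives_inhomogeneous:
  assumes E: "interm E" and T: "finite T" "T \<subseteq> M" "D ` T \<subseteq> E"
    and b: "b \<in> field_gen (E \<union> T)" "D b + q * b \<in> E" and q: "q \<in> E"
    and hom: "\<And>e. e \<in> field_gen (E \<union> T) \<Longrightarrow> D e + q * e = 0 \<Longrightarrow> e = 0"
  shows "b \<in> E"
  using E T
proof (rule adjoin_primitives_induct[where P = "\<lambda>b. D b + q * b \<in> E"])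
  fix S t u assume *: "interm S" "E \<subseteq> S" "S \<subseteq> field_gen (E \<union> T)" "t \<in> M" "D t \<in> E"
    "u \<in> field_gen (insert t S)" "D u + q * u \<in> E"
  show "u \<in> S"
    by (rule adjoin_primitive_inhomogeneous[of S t u q]) (use * q hom in auto)
qed (use b in auto)

text \<open>Ostrowski's theorem in linear form. Splitting off c \<open>f n\<close> leaves a
  remainder whose derivative is still in \<open>E\<close>, since c is constant; if
  \<open>f n\<close> is algebraic over the preceding field it lies there already and c = 0
  serves.\<close>

lemma adjoin_primitives_primitive:
  fixes n :: nat
  assumes E: "interm E" and f: "\<And>i. i < n \<Longrightarrow> f i \<in> M" "\<And>i. i < n \<Longrightarrow> D (f i) \<in> E"
    and u: "u \<in> field_gen (E \<union> f ` {..<n})" and Du: "D u \<in> E"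
  obtains c e where "\<And>i. c i \<in> K" "\<And>i. D (c i) = 0" "e \<in> E" "u = (\<Sum>i<n. c i * f i) + e"
proof -
  have "\<exists>c e. (\<forall>i. c i \<in> K \<and> D (c i) = 0) \<and> e \<in> E \<and> u = (\<Sum>i<n. c i * f i) + e"
    using f u Du
  proof (induction n arbitrary: u)
    case 0
    then have "u \<in> E" using field_gen_eq[OF interm_subfield[OF E]] by simp
    then show ?case using subfield_zero[OF K] by (intro exI[of _ "\<lambda>_. 0"]) (auto simp: der_0[OF D])
  next
    case (Suc n)
    let ?S = "field_gen (E \<union> f ` {..<n})"
    have S: "interm ?S" using Suc.prems by (intro interm_adjoin_primitives[OF E]) auto
    have ES: "E \<subseteq> ?S" using subset_field_gen by blast
    have eq: "field_gen (E \<union> f ` {..<Suc n}) = field_gen (insert (f n) ?S)"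
      using field_gen_insert_eq[of "E \<union> f ` {..<n}" "{f n}"] by (simp add: lessThan_Suc)
    have "\<exists>c e. c \<in> K \<and> D c = 0 \<and> e \<in> ?S \<and> u = c * f n + e"
    proof (cases "transcendental_over ?S (f n)")
      case True
      have "f n \<in> M" "D (f n) \<in> ?S" "u \<in> field_gen (insert (f n) ?S)" "D u \<in> ?S"
        using Suc.prems ES eq by auto
      from adjoin_primitive_primitive[OF S this(1,2) True this(3,4)] show ?thesis by metis
    next
      case False
      have "f n \<in> M" "D (f n) \<in> ?S" using Suc.prems(1,2)[of n] ES by auto
      then have "f n \<in> ?S" by (rule primitive_algebraic[OF S _ _ False])
      then have "u \<in> ?S" using Suc.prems(3) eq by (simp add: insert_absorb field_gen_eq[OF is_subfield_field_gen])
      then show ?thesis using subfield_zero[OF K] der_0[OF D] by (intro exI[of _ 0] exI[of _ u]) auto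
    qed
    then obtain c e where ce: "c \<in> K" "D c = 0" "e \<in> ?S" "u = c * f n + e" by blast
    then have "D e = D u - c * D (f n)" by (simp add: der_add[OF D] der_mult[OF D])
    also have "\<dots> \<in> E"
      using Suc.prems ce interm_K[OF E] by (auto intro!: subfield_diff subfield_mult interm_subfield[OF E])
    finally obtain c' e' where c': "\<forall>i. c' i \<in> K \<and> D (c' i) = 0" "e' \<in> E" "e = (\<Sum>i<n. c' i * f i) + e'"
      using Suc.IH[of e] Suc.prems ce by auto
    show ?case
      using c' ce by (intro exI[of _ "c'(n := c)"] exI[of _ e']) auto
  qed
  then obtain c e where "\<forall>i. c i \<in> K \<and> D (c i) = 0" "e \<in> E" "u = (\<Sum>i<n. c i * f i) + e" by blast
  then show ?thesis by (intro that[of c e]) simp_all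
qed

end

section \<open>Algebraic independence\<close>

text \<open>Polynomials in the first \<open>n\<close> variables, encoded as coefficient functions on
  exponent vectors to match \<open>alg_indep_over\<close>.\<close>

definition mon_supp :: "nat \<Rightarrow> ((nat \<Rightarrow> nat) \<Rightarrow> 'a::zero) \<Rightarrow> bool" where
  "mon_supp n c \<longleftrightarrow> finite {m. c m \<noteq> 0} \<and> (\<forall>m i. c m \<noteq> 0 \<longrightarrow> n \<le> i \<longrightarrow> m i = 0)"

definition mon_eval :: "(nat \<Rightarrow> 'a::field) \<Rightarrow> nat \<Rightarrow> ((nat \<Rightarrow> nat) \<Rightarrow> 'a) \<Rightarrow> 'a" where
  "mon_eval f n c = (\<Sum>m\<in>{m. c m \<noteq> 0}. c m * (\<Prod>i<n. f i ^ m i))"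

text \<open>A relation has finitely many monomials, each in finitely many variables, so some
  \<open>n\<close> bounds them all. The bounded form permits induction on the number of
  variables.\<close>

lemma alg_indep_over_iff:
  "alg_indep_over K f \<longleftrightarrow>
     (\<forall>n c. mon_supp n c \<and> range c \<subseteq> K \<and> mon_eval f n c = 0 \<longrightarrow> c = (\<lambda>_. 0))"
proof -
  have prod: "(\<Prod>i\<in>{i. m i \<noteq> 0}. f i ^ m i) = (\<Prod>i<n. f i ^ m i)"
    if "\<forall>i\<ge>n. m i = 0" for m n
    using that by (intro prod.mono_neutral_left) (auto intro: leI)
  have eval: "mon_eval f n c = (\<Sum>m\<in>{m. c m \<noteq> 0}. c m * (\<Prod>i\<in>{i. m i \<noteq> 0}. f i ^ m i))"
    if "mon_supp n c" for n c
    unfolding mon_eval_def using that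
    by (intro sum.cong refl arg_cong2[of _ _ _ _ "(*)"] prod[symmetric]) (simp add: mon_supp_def)
  show ?thesis
  proof (intro iffI allI impI)
    fix n and c :: "(nat \<Rightarrow> nat) \<Rightarrow> 'a"
    assume f: "alg_indep_over K f" and "mon_supp n c \<and> range c \<subseteq> K \<and> mon_eval f n c = 0"
    then have c: "mon_supp n c" "range c \<subseteq> K" "mon_eval f n c = 0" by auto
    have "{i. m i \<noteq> 0} \<subseteq> {..<n}" if "c m \<noteq> 0" for m
    proof
      fix i assume "i \<in> {i. m i \<noteq> 0}"
      moreover have "n \<le> i \<Longrightarrow> m i = 0" using c(1) that by (simp add: mon_supp_def)
      ultimately have "\<not> n \<le> i" by auto
      then show "i \<in> {..<n}" by simp
    qed
    then have "\<forall>m. c m \<noteq> 0 \<longrightarrow> finite {i. m i \<noteq> 0}"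
      using finite_subset by blast
    moreover have "finite {m. c m \<noteq> 0}" using c(1) by (simp add: mon_supp_def)
    moreover have "\<forall>m. c m \<in> K" using c(2) by blast
    ultimately have "\<forall>m. c m = 0"
      using f[unfolded alg_indep_over_def, THEN spec, of c] c(3)[unfolded eval[OF c(1)]] by blast
    then show "c = (\<lambda>_. 0)" by auto
  next
    assume *: "\<forall>n c. mon_supp n c \<and> range c \<subseteq> K \<and> mon_eval f n c = 0 \<longrightarrow> c = (\<lambda>_. 0)"
    show "alg_indep_over K f"
      unfolding alg_indep_over_def
    proof (intro allI impI; elim conjE)
      fix c :: "(nat \<Rightarrow> nat) \<Rightarrow> 'a" and m
      assume c: "finite {m. c m \<noteq> 0}" "\<forall>m. c m \<noteq> 0 \<longrightarrow> finite {i. m i \<noteq> 0}" "\<forall>m. c m \<in> K"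
        "(\<Sum>m\<in>{m. c m \<noteq> 0}. c m * (\<Prod>i\<in>{i. m i \<noteq> 0}. f i ^ m i)) = 0"
      have "finite (\<Union>m\<in>{m. c m \<noteq> 0}. {i. m i \<noteq> 0})" using c by auto
      then obtain n where "(\<Union>m\<in>{m. c m \<noteq> 0}. {i. m i \<noteq> 0}) \<subseteq> {..<n}"
        using finite_nat_iff_bounded by blast
      then have n: "\<And>m i. c m \<noteq> 0 \<Longrightarrow> m i \<noteq> 0 \<Longrightarrow> i < n" by blast
      have s: "mon_supp n c"
        unfolding mon_supp_def using c(1) n by (metis leD)
      have "c = (\<lambda>_. 0)"
        using *[THEN spec, of n, THEN spec, of c] s c(3) c(4)[folded eval[OF s]] by blast
      then show "c m = 0" by simp
    qed
  qed
qed

text \<open>The coefficient of the \<open>k\<close>-th power of variable \<open>n\<close>. The test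
  \<open>m n = 0\<close> makes it a polynomial in which that variable does not occur.\<close>

definition mon_slice :: "nat \<Rightarrow> nat \<Rightarrow> ((nat \<Rightarrow> nat) \<Rightarrow> 'a::zero) \<Rightarrow> (nat \<Rightarrow> nat) \<Rightarrow> 'a" where
  "mon_slice n k c m = (if m n = 0 then c (m(n := k)) else 0)"

definition mon_join :: "nat \<Rightarrow> (nat \<Rightarrow> (nat \<Rightarrow> nat) \<Rightarrow> 'a::zero) \<Rightarrow> (nat \<Rightarrow> nat) \<Rightarrow> 'a" where
  "mon_join n cc m = cc (m n) (m(n := 0))"

lemma mon_join_slice: "mon_join n (\<lambda>k. mon_slice n k c) = c"
  by (auto simp: mon_join_def mon_slice_def)

lemma mon_supp_slice:
  assumes "mon_supp (Suc n) c"
  shows "mon_supp n (mon_slice n k c)"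
proof -
  have "{m. mon_slice n k c m \<noteq> 0} \<subseteq> (\<lambda>m. m(n := 0)) ` {m. c m \<noteq> 0}"
  proof
    fix m assume "m \<in> {m. mon_slice n k c m \<noteq> 0}"
    then have "c (m(n := k)) \<noteq> 0" "m n = 0" by (auto simp: mon_slice_def split: if_splits)
    then have "m(n := k) \<in> {m. c m \<noteq> 0}" "m = (m(n := k))(n := 0)" by (auto simp: fun_eq_iff)
    then show "m \<in> (\<lambda>m. m(n := 0)) ` {m. c m \<noteq> 0}" by blast
  qed
  moreover have "m i = 0" if "mon_slice n k c m \<noteq> 0" "n \<le> i" for m i
  proof (cases "i = n")
    case False
    then have "c (m(n := k)) \<noteq> 0" "Suc n \<le> i" using that by (auto simp: mon_slice_def split: if_splits)
    then have "(m(n := k)) i = 0" using assms unfolding mon_supp_def by blast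
    then show ?thesis using False by simp
  qed (use that in \<open>auto simp: mon_slice_def split: if_splits\<close>)
  ultimately show ?thesis
    using assms finite_subset unfolding mon_supp_def by blast
qed

lemma mon_join_support:
  assumes cc: "\<And>k. mon_supp n (cc k)" and d: "\<And>k. k > d \<Longrightarrow> cc k = (\<lambda>_. 0)"
  shows "{m. mon_join n cc m \<noteq> 0} = (\<lambda>(k, m). m(n := k)) ` (SIGMA k:{..d}. {m. cc k m \<noteq> 0})"
proof (intro equalityI subsetI)
  fix m assume m: "m \<in> {m. mon_join n cc m \<noteq> 0}"
  then have "cc (m n) (m(n := 0)) \<noteq> 0" by (simp add: mon_join_def)
  moreover from this have "m n \<le> d" using d[of "m n"] by (cases "m n \<le> d") auto
  ultimately have "(m n, m(n := 0)) \<in> (SIGMA k:{..d}. {m. cc k m \<noteq> 0})" by simp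
  moreover have "m = (\<lambda>(k, m). m(n := k)) (m n, m(n := 0))" by simp
  ultimately show "m \<in> (\<lambda>(k, m). m(n := k)) ` (SIGMA k:{..d}. {m. cc k m \<noteq> 0})" by blast
next
  fix m assume "m \<in> (\<lambda>(k, m). m(n := k)) ` (SIGMA k:{..d}. {m. cc k m \<noteq> 0})"
  then obtain k m' where m': "m = m'(n := k)" "cc k m' \<noteq> 0" by auto
  then have "m' n = 0" using cc[of k] by (simp add: mon_supp_def)
  then have "m'(n := 0) = m'" by auto
  then show "m \<in> {m. mon_join n cc m \<noteq> 0}" using m' by (simp add: mon_join_def)
qed

lemma mon_supp_join:
  assumes cc: "\<And>k. mon_supp n (cc k)" and d: "\<And>k. k > d \<Longrightarrow> cc k = (\<lambda>_. 0)"
  shows "mon_supp (Suc n) (mon_join n cc)"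
  unfolding mon_supp_def
proof (intro conjI allI impI)
  show "finite {m. mon_join n cc m \<noteq> 0}"
  proof -
    have "finite ((\<lambda>(k, m). m(n := k)) ` (SIGMA k:{..d}. {m. cc k m \<noteq> 0}))"
      using cc by (intro finite_imageI finite_SigmaI) (auto simp: mon_supp_def)
    with mon_join_support[OF assms] show ?thesis by simp
  qed
  fix m i assume "mon_join n cc m \<noteq> 0" "Suc n \<le> i"
  then show "m i = 0"
    using cc[of "m n"] unfolding mon_supp_def mon_join_def
    by (metis Suc_leD Suc_n_not_le_n fun_upd_other)
qed

lemma mon_eval_join:
  assumes cc: "\<And>k. mon_supp n (cc k)" and d: "\<And>k. k > d \<Longrightarrow> cc k = (\<lambda>_. 0)"
  shows "mon_eval f (Suc n) (mon_join n cc) = (\<Sum>k\<le>d. mon_eval f n (cc k) * f n ^ k)"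
proof -
  let ?A = "SIGMA k:{..d}. {m. cc k m \<noteq> 0}"
  let ?g = "\<lambda>(k, m). m(n := k)"
  have z: "m n = 0" if "(k, m) \<in> ?A" for k m
    using cc[of k] that by (auto simp: mon_supp_def)
  \<comment> \<open>Position \<open>n\<close> reveals the exponent \<open>k\<close>; the rest is
    determined because supported vectors vanish at \<open>n\<close>.\<close>
  have inj: "inj_on ?g ?A"

  proof (rule inj_onI)
    fix x y
    assume xy: "x \<in> ?A" "y \<in> ?A" "?g x = ?g y"
    obtain k m k' m' where x: "x = (k, m)" and y: "y = (k', m')" by (cases x, cases y)
    have *: "(k, m) \<in> ?A" "(k', m') \<in> ?A" and eq: "m(n := k) = m'(n := k')"
      using xy by (auto simp: x y)
    have "k = k'" using fun_cong[OF eq, of n] by simp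
    moreover have "m = m'"
    proof (rule ext)
      fix i show "m i = m' i" using fun_cong[OF eq, of i] z[OF *(1)] z[OF *(2)] by (cases "i = n") auto
    qed
    ultimately show "x = y" by (simp add: x y)
  qed
  have "mon_eval f (Suc n) (mon_join n cc) =
      (\<Sum>x\<in>?A. mon_join n cc (?g x) * (\<Prod>i<Suc n. f i ^ (?g x) i))"
    by (simp only: mon_eval_def mon_join_support[of n cc d, OF assms] sum.reindex[OF inj] o_def)
  also have "\<dots> = (\<Sum>(k, m)\<in>?A. cc k m * (\<Prod>i<n. f i ^ m i) * f n ^ k)"
  proof (intro sum.cong refl)
    fix x assume "x \<in> ?A"
    then obtain k m where x: "x = (k, m)" and *: "(k, m) \<in> ?A" by (cases x) auto
    then have "m n = 0" using z by blast
    then have "m(n := 0) = m" by auto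
    moreover have "(\<Prod>i<n. f i ^ (m(n := k)) i) = (\<Prod>i<n. f i ^ m i)"
      by (intro prod.cong) auto
    ultimately show "mon_join n cc (?g x) * (\<Prod>i<Suc n. f i ^ (?g x) i) =
        (case x of (k, m) \<Rightarrow> cc k m * (\<Prod>i<n. f i ^ m i) * f n ^ k)"
      by (simp add: mon_join_def x)
  qed
  also have "\<dots> = (\<Sum>k\<le>d. \<Sum>m\<in>{m. cc k m \<noteq> 0}. cc k m * (\<Prod>i<n. f i ^ m i) * f n ^ k)"
    using cc by (subst sum.Sigma) (auto simp: mon_supp_def)
  finally show ?thesis by (simp add: mon_eval_def sum_distrib_right)
qed

lemma mon_slice_bounded:
  assumes "mon_supp (Suc n) c"
  obtains d where "\<And>k. k > d \<Longrightarrow> mon_slice n k c = (\<lambda>_. 0)"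
proof -
  have fin: "finite ((\<lambda>m. m n) ` {m. c m \<noteq> 0})" using assms by (simp add: mon_supp_def)
  have "mon_slice n k c = (\<lambda>_. 0)" if k: "k > Max ((\<lambda>m. m n) ` {m. c m \<noteq> 0})" for k
  proof
    fix m
    have "c (m(n := k)) = 0"
    proof (rule ccontr)
      assume "c (m(n := k)) \<noteq> 0"
      then have "k \<in> (\<lambda>m. m n) ` {m. c m \<noteq> 0}" by (intro image_eqI[of _ _ "m(n := k)"]) auto
      then show False using Max_ge[OF fin] k by force
    qed
    then show "mon_slice n k c m = 0" by (simp add: mon_slice_def)
  qed
  then show ?thesis using that by blast
qed

text \<open>The ring K[f 0, ..., f (n - 1)] in terms of coefficient functions; it also arises by
  iterating \<open>ring_adjoin\<close>.\<close>

definition mon_ring :: "'a::field set \<Rightarrow> (nat \<Rightarrow> 'a) \<Rightarrow> nat \<Rightarrow> 'a set" where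
  "mon_ring K f n = {mon_eval f n c | c. mon_supp n c \<and> range c \<subseteq> K}"

lemma mon_ringI: "mon_supp n c \<Longrightarrow> range c \<subseteq> K \<Longrightarrow> mon_eval f n c \<in> mon_ring K f n"
  unfolding mon_ring_def by (intro CollectI exI[of _ c] conjI refl)

lemma mon_eval_0: "mon_eval f 0 c = c (\<lambda>_. 0)" if "mon_supp 0 c"
proof -
  have "{m. c m \<noteq> 0} \<subseteq> {\<lambda>_. 0}" using that by (auto simp: mon_supp_def)
  then have "mon_eval f 0 c = (\<Sum>m\<in>{\<lambda>_. 0}. c m * (\<Prod>i<0. f i ^ m i))"
    unfolding mon_eval_def by (intro sum.mono_neutral_left) auto
  then show ?thesis by simp
qed

lemma mon_ring_0:
  assumes "0 \<in> K"
  shows "mon_ring K f 0 = K"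
proof (intro equalityI subsetI)
  fix u assume "u \<in> mon_ring K f 0"
  then show "u \<in> K" by (auto simp: mon_ring_def mon_eval_0)
next
  fix u assume u: "u \<in> K"
  let ?c = "\<lambda>m::nat \<Rightarrow> nat. if m = (\<lambda>_. 0) then u else 0"
  have "mon_supp 0 ?c" by (auto simp: mon_supp_def)
  moreover from this have "u = mon_eval f 0 ?c" by (simp add: mon_eval_0)
  moreover have "range ?c \<subseteq> K" using u assms by auto
  ultimately show "u \<in> mon_ring K f 0" by (metis mon_ringI)
qed

lemma mon_slice_range: "0 \<in> K \<Longrightarrow> range c \<subseteq> K \<Longrightarrow> range (mon_slice n k c) \<subseteq> K"
  by (auto simp: mon_slice_def)

lemma mon_eval_poly:
  assumes K: "is_subring K" and c: "mon_supp (Suc n) c" "range c \<subseteq> K"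
  obtains P where "P \<in> poly_over (mon_ring K f n)" "poly P (f n) = mon_eval f (Suc n) c"
    "\<And>k. coeff P k = mon_eval f n (mon_slice n k c)"
proof -
  note sl = mon_supp_slice[OF c(1)]
  note R = mon_slice_range[OF subring_zero[OF K] c(2), of n]
  obtain d where d: "\<And>k. k > d \<Longrightarrow> mon_slice n k c = (\<lambda>_. 0)"
    using mon_slice_bounded[OF c(1)] by blast
  define P where "P = (\<Sum>k\<le>d. monom (mon_eval f n (mon_slice n k c)) k)"
  have coeff: "coeff P k = mon_eval f n (mon_slice n k c)" for k
    using d[of k] by (cases "k \<le> d") (auto simp: P_def coeff_sum mon_eval_def)
  show ?thesis
  proof
    show "P \<in> poly_over (mon_ring K f n)"
      by (intro poly_overI) (simp only: coeff mon_ringI sl R)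
    have "mon_eval f (Suc n) c = (\<Sum>k\<le>d. mon_eval f n (mon_slice n k c) * f n ^ k)"
      using mon_eval_join[of n "\<lambda>k. mon_slice n k c" d f, OF sl d] by (simp add: mon_join_slice)
    then show "poly P (f n) = mon_eval f (Suc n) c"
      by (simp add: P_def poly_sum poly_monom)
  qed (rule coeff)
qed

text \<open>Converse passage to \<open>mon_eval_poly\<close>. The last conclusion guarantees that a
  nontrivial polynomial in \<open>f n\<close> yields a nontrivial relation in all variables.\<close>

lemma poly_mon_eval:
  assumes K: "is_subring K" and P: "P \<in> poly_over (mon_ring K f n)"
  obtains c where "mon_supp (Suc n) c" "range c \<subseteq> K" "mon_eval f (Suc n) c = poly P (f n)"
    "c = (\<lambda>_. 0) \<longrightarrow> P = 0"
proof -
  have "\<forall>k. \<exists>c. mon_supp n c \<and> range c \<subseteq> K \<and> coeff P k = mon_eval f n c"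
    using poly_overD[OF P] unfolding mon_ring_def by blast
  then obtain c0 where c0: "\<And>k. mon_supp n (c0 k)" "\<And>k m. c0 k m \<in> K"
    "\<And>k. coeff P k = mon_eval f n (c0 k)" by (metis rangeI subsetD)
  \<comment> \<open>Above the degree, the chosen \<open>c0 k\<close> could be a nonzero function
    with value 0; it is replaced by zero to keep the support finite.\<close>
  define cc where "cc k = (if k \<le> degree P then c0 k else (\<lambda>_. 0))" for k
  have supp: "mon_supp n (cc k)" for k using c0(1) by (simp add: cc_def mon_supp_def)
  have z: "cc k = (\<lambda>_. 0)" if "k > degree P" for k using that by (simp add: cc_def)
  show ?thesis
  proof
    show "mon_supp (Suc n) (mon_join n cc)" by (rule mon_supp_join[of n cc "degree P", OF supp z])
    show "range (mon_join n cc) \<subseteq> K"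
      using c0(2) subring_zero[OF K] by (auto simp: mon_join_def cc_def)
    show "mon_eval f (Suc n) (mon_join n cc) = poly P (f n)"
      using mon_eval_join[of n cc "degree P" f, OF supp z] c0(3) by (simp add: poly_altdef cc_def)
    show "mon_join n cc = (\<lambda>_. 0) \<longrightarrow> P = 0"
    proof
      assume *: "mon_join n cc = (\<lambda>_. 0)"
      have "cc k m = 0" for k m
      proof (cases "m n = 0")
        case True
        then have "m(n := 0) = m" by auto
        then have "cc k m = mon_join n cc (m(n := k))" by (simp add: mon_join_def)
        then show ?thesis by (simp add: *)
      qed (use supp[of k] in \<open>auto simp: mon_supp_def\<close>)
      then have cc0: "cc k = (\<lambda>_. 0)" for k by auto
      have "coeff P k = mon_eval f n (\<lambda>_. 0)" for k
        using c0(3)[of k] cc0[of k] by (cases "k \<le> degree P") (auto simp: cc_def mon_eval_def coeff_eq_0)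
      then have "coeff P k = 0" for k by (simp add: mon_eval_def)
      then show "P = 0" by (simp add: poly_eq_iff)
    qed
  qed
qed

lemma mon_ring_Suc:
  assumes "is_subring K"
  shows "mon_ring K f (Suc n) = ring_adjoin (mon_ring K f n) (f n)"
proof (intro equalityI subsetI)
  fix u assume "u \<in> mon_ring K f (Suc n)"
  then obtain c where c: "mon_supp (Suc n) c" "range c \<subseteq> K" "u = mon_eval f (Suc n) c"
    by (auto simp: mon_ring_def)
  from mon_eval_poly[OF assms c(1,2), of f] c(3) show "u \<in> ring_adjoin (mon_ring K f n) (f n)"
    by (metis ring_adjoinI)
next
  fix u assume "u \<in> ring_adjoin (mon_ring K f n) (f n)"
  then obtain P where P: "P \<in> poly_over (mon_ring K f n)" "u = poly P (f n)" by (rule ring_adjoinE)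
  from poly_mon_eval[OF assms P(1)] obtain c where
    "mon_supp (Suc n) c" "range c \<subseteq> K" "mon_eval f (Suc n) c = u" using P(2) by metis
  then show "u \<in> mon_ring K f (Suc n)" using mon_ringI by blast
qed

lemma is_subring_mon_ring: "is_subring K \<Longrightarrow> is_subring (mon_ring K f n)"
  by (induction n) (simp_all add: mon_ring_0 subring_zero mon_ring_Suc is_subring_ring_adjoin)

lemma mon_ring_generators:
  assumes "is_subring K"
  shows "K \<union> f ` {..<n} \<subseteq> mon_ring K f n"
proof (induction n)
  case (Suc n)
  note R = is_subring_mon_ring[OF assms, of f n]
  have "mon_ring K f n \<subseteq> mon_ring K f (Suc n)" "f n \<in> mon_ring K f (Suc n)"
    using base_in_ring_adjoin[OF R] gen_in_ring_adjoin[OF R] by (auto simp: mon_ring_Suc[OF assms])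
  then show ?case using Suc by (auto simp: lessThan_Suc)
qed (simp add: mon_ring_0 subring_zero assms)

lemma mon_ring_subset:
  assumes K: "is_subring K"
  shows "mon_ring K f n \<subseteq> field_gen (K \<union> f ` {..<n})"
proof (induction n)
  case 0
  show ?case using subset_field_gen by (auto simp: mon_ring_0 subring_zero K)
next
  case (Suc n)
  let ?L = "field_gen (K \<union> f ` {..<Suc n})"
  have "mon_ring K f n \<subseteq> ?L"
    using Suc field_gen_mono[of "K \<union> f ` {..<n}" "K \<union> f ` {..<Suc n}"] by (auto simp: lessThan_Suc)
  moreover have "f n \<in> ?L" using subset_field_gen[of "K \<union> f ` {..<Suc n}"] by auto
  ultimately show ?case
    by (auto simp: mon_ring_Suc[OF K] elim!: ring_adjoinE
        intro!: poly_in_subring is_subring_subfield is_subfield_field_gen intro: poly_over_mono)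
qed

text \<open>A relation is a polynomial in the last \<open>f n\<close> over the field of the earlier
  ones. Transcendence kills its coefficients, which are relations in fewer variables.\<close>

lemma alg_indep_overI:
  assumes K: "is_subfield K"
    and f: "\<And>n. transcendental_over (field_gen (K \<union> f ` {..<n})) (f n)"
  shows "alg_indep_over K f"
proof -
  note R = is_subring_subfield[OF K]
  have "c = (\<lambda>_. 0)" if "mon_supp n c" "range c \<subseteq> K" "mon_eval f n c = 0" for n c
    using that
  proof (induction n arbitrary: c)
    case 0
    then have "c m = 0" for m
      using mon_eval_0[OF 0(1), of f] by (cases "m = (\<lambda>_. 0)") (auto simp: mon_supp_def)
    then show ?case by auto
  next
    case (Suc n)
    from mon_eval_poly[OF R Suc.prems(1,2), of f] obtain P where
      P: "P \<in> poly_over (mon_ring K f n)" "poly P (f n) = mon_eval f (Suc n) c"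
      and coeff: "\<And>k. coeff P k = mon_eval f n (mon_slice n k c)" by metis
    have "P = 0"
      using transcendental_over_iff[OF is_subring_subfield[OF is_subfield_field_gen], THEN iffD1, OF f[of n]]
        poly_over_mono[OF mon_ring_subset[OF R] P(1)] P(2) Suc.prems(3) by simp
    then have "mon_slice n k c = (\<lambda>_. 0)" for k
      using coeff[of k] mon_supp_slice[OF Suc.prems(1)]
        mon_slice_range[OF subring_zero[OF R] Suc.prems(2)] by (intro Suc.IH) auto
    then show ?case
      using mon_join_slice[of n c] by (auto simp: mon_join_def)
  qed
  then show ?thesis unfolding alg_indep_over_iff by blast
qed

lemma alg_indep_over_notin:
  assumes K: "is_subfield K" and f: "alg_indep_over K f"
  shows "f n \<notin> field_gen (K \<union> f ` {..<n})"
proof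
  note R = is_subring_subfield[OF K]
  note R' = is_subring_mon_ring[OF R, of f n]
  assume "f n \<in> field_gen (K \<union> f ` {..<n})"
  then obtain b where b: "b \<in> mon_ring K f n" "b \<noteq> 0" "b * f n \<in> mon_ring K f n"
    using field_gen_fraction[OF R' mon_ring_generators[OF R]] by metis
  \<comment> \<open>Clearing the denominator \<open>b\<close> gives a polynomial of degree one that
    vanishes at \<open>f n\<close>.\<close>
  let ?P = "[:- (b * f n), b:]"
  have "?P \<in> poly_over (mon_ring K f n)"
    using b subring_diff[OF R' subring_zero[OF R'] b(3)]
    by (intro poly_over_pCons[OF R'] poly_over_0[OF R']) auto
  from poly_mon_eval[OF R this] obtain c where
    c: "mon_supp (Suc n) c" "range c \<subseteq> K" "mon_eval f (Suc n) c = poly ?P (f n)" "c = (\<lambda>_. 0) \<longrightarrow> ?P = 0" .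
  have "c = (\<lambda>_. 0)"
    using f[unfolded alg_indep_over_iff, THEN spec, of "Suc n", THEN spec, of c] c(1-3)
    by (simp add: mult.commute)
  then show False using c(4) b(2) by simp
qed

section \<open>Creative telescoping\<close>

text \<open>Gaussian elimination inside \<open>F\<close>, by induction on the number of equations;
  the solution has to lie in the subfield, not merely in the ambient type.\<close>

lemma homogeneous_system_nontrivial:
  fixes A :: "nat \<Rightarrow> 'b \<Rightarrow> 'a::field"
  assumes F: "is_subfield F" and "finite I" "m < card I"
    and "\<And>j i. j < m \<Longrightarrow> i \<in> I \<Longrightarrow> A j i \<in> F"
  shows "\<exists>v. (\<forall>i. v i \<in> F) \<and> (\<exists>i\<in>I. v i \<noteq> 0) \<and> (\<forall>j<m. (\<Sum>i\<in>I. A j i * v i) = 0)"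
  using assms(2-)
proof (induction m arbitrary: I A)
  case 0
  then obtain i where "i \<in> I" by fastforce
  then show ?case using subfield_one[OF F] by (intro exI[of _ "\<lambda>_. 1"]) auto
next
  case (Suc m)
  show ?case
  proof (cases "\<forall>i\<in>I. A m i = 0")
    case True
    have "\<exists>v. (\<forall>i. v i \<in> F) \<and> (\<exists>i\<in>I. v i \<noteq> 0) \<and> (\<forall>j<m. (\<Sum>i\<in>I. A j i * v i) = 0)"
      using Suc.prems by (intro Suc.IH) auto
    then show ?thesis using True by (auto simp: less_Suc_eq)
  next
    case False
    then obtain k where k: "k \<in> I" "A m k \<noteq> 0" by blast
    let ?I = "I - {k}"
    let ?B = "\<lambda>j i. A j i - A j k / A m k * A m i"
    have "\<exists>v. (\<forall>i. v i \<in> F) \<and> (\<exists>i\<in>?I. v i \<noteq> 0) \<and> (\<forall>j<m. (\<Sum>i\<in>?I. ?B j i * v i) = 0)"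
    proof (rule Suc.IH)
      show "m < card ?I" using Suc.prems k by (simp add: card_Diff_singleton)
      show "?B j i \<in> F" if "j < m" "i \<in> ?I" for j i
        using that k Suc.prems(3) by (intro subfield_diff[OF F] subfield_mult[OF F] subfield_divide[OF F]) auto
    qed (use Suc.prems in auto)
    then obtain v where v: "\<And>i. v i \<in> F" "\<exists>i\<in>?I. v i \<noteq> 0"
      and 0: "\<And>j. j < m \<Longrightarrow> (\<Sum>i\<in>?I. ?B j i * v i) = 0" by blast
    let ?s = "\<lambda>j. \<Sum>i\<in>?I. A j i * v i"
    \<comment> \<open>The pivot unknown \<open>k\<close> is recovered from equation
      \<open>m\<close>.\<close>
    let ?w = "v(k := - ?s m / A m k)"
    have s: "?s j = A j k / A m k * ?s m" if "j < m" for j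
      using 0[OF that] by (simp add: left_diff_distrib sum_subtractf sum_distrib_left mult.assoc)
    have split: "(\<Sum>i\<in>I. A j i * ?w i) = A j k * (- ?s m / A m k) + ?s j" for j
      using k Suc.prems(1) by (subst sum.remove[of _ k]) auto
    have "?s m \<in> F"
      using Suc.prems(3) v(1) by (intro subfield_sum[OF F] subfield_mult[OF F]) auto
    then have "?w i \<in> F" for i
      using v(1) k Suc.prems(3) by (auto intro!: subfield_divide[OF F] subfield_uminus[OF F])
    moreover have "\<exists>i\<in>I. ?w i \<noteq> 0" using v(2) by auto
    moreover have "(\<Sum>i\<in>I. A j i * ?w i) = 0" if "j < Suc m" for j
    proof (cases "j = m")
      case True
      then show ?thesis unfolding split using k by simp
    next
      case False
      then have "?s j = A j k / A m k * ?s m" using that by (intro s) simp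
      then show ?thesis unfolding split by simp
    qed
    ultimately show ?thesis by blast
  qed
qed

text \<open>The coefficients up to degree \<open>k\<close> give \<open>k + 1\<close> equations, and
  \<open>v d = 0\<close> is encoded as one more row, against more than \<open>k + 2\<close>
  unknowns.\<close>

lemma polynomials_dependent:
  fixes W :: "nat \<Rightarrow> 'a::field poly"
  assumes F: "is_subfield F" and W: "\<And>i. i < N \<Longrightarrow> W i \<in> poly_over F" "\<And>i. i < N \<Longrightarrow> degree (W i) \<le> k"
    and N: "k + 2 < N"
  obtains v where "\<And>i. v i \<in> F" "\<exists>i<N. v i \<noteq> 0" "d < N \<Longrightarrow> v d = 0" "(\<Sum>i<N. smult (v i) (W i)) = 0"
proof -
  let ?A = "\<lambda>j i. if j \<le> k then coeff (W i) j else if i = d then 1 else 0"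
  have "\<exists>v. (\<forall>i. v i \<in> F) \<and> (\<exists>i\<in>{..<N}. v i \<noteq> 0) \<and> (\<forall>j<k+2. (\<Sum>i<N. ?A j i * v i) = 0)"
    using N W(1) by (intro homogeneous_system_nontrivial[OF F])
      (auto simp: poly_over_def intro: subfield_zero[OF F] subfield_one[OF F])
  then obtain v where v: "\<And>i. v i \<in> F" "\<exists>i\<in>{..<N}. v i \<noteq> 0"
    and 0: "\<And>j. j < k + 2 \<Longrightarrow> (\<Sum>i<N. ?A j i * v i) = 0" by blast
  have "v d = 0" if "d < N"
  proof -
    have "(\<Sum>i<N. if i = d then v i else 0) = (\<Sum>i<N. ?A (Suc k) i * v i)"
      by (intro sum.cong) auto
    also have "\<dots> = 0" by (intro 0) simp
    finally show ?thesis using that by simp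
  qed
  moreover have "coeff (\<Sum>i<N. smult (v i) (W i)) j = 0" for j
  proof (cases "j \<le> k")
    case True
    then show ?thesis using 0[of j] by (simp add: coeff_sum mult.commute)
  next
    case False
    then have "coeff (W i) j = 0" if "i < N" for i using W(2)[OF that] by (intro coeff_eq_0) simp
    then show ?thesis by (simp add: coeff_sum)
  qed
  then have "(\<Sum>i<N. smult (v i) (W i)) = 0" by (simp add: poly_eq_iff)
  ultimately show ?thesis using that v by blast
qed

lemma coeff_mult_top:
  fixes P Q :: "'a::idom poly"
  assumes "degree P \<le> m" "degree Q \<le> n"
  shows "coeff (P * Q) (m + n) = coeff P m * coeff Q n"
proof (cases "degree P = m \<and> degree Q = n")
  case True
  then show ?thesis using coeff_mult_degree_sum[of P Q] by simp
next
  case False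
  then have "degree P + degree Q < m + n" "coeff P m = 0 \<or> coeff Q n = 0"
    using assms by (auto intro: coeff_eq_0)
  moreover from this have "degree (P * Q) < m + n" using degree_mult_le le_less_trans by blast
  ultimately show ?thesis by (auto simp: coeff_eq_0)
qed

text \<open>The operator \<open>P \<mapsto> q P' + r P\<close> has a kernel of dimension at most one; only the consequence on
  degrees matters.\<close>

lemma first_order_kernel_degree:
  fixes P Q q r :: "'a::field_char_0 poly"
  assumes "q \<noteq> 0" "P \<noteq> 0" "Q \<noteq> 0" and "q * pderiv P + r * P = 0" "q * pderiv Q + r * Q = 0"
  shows "degree P = degree Q"
proof -
  let ?X = "[:0, 1:]"
  \<comment> \<open>The Wronskian of two kernel elements vanishes.\<close>
  have "q * (pderiv P * Q - P * pderiv Q) = (q * pderiv P + r * P) * Q - P * (q * pderiv Q + r * Q)"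
    by (simp add: algebra_simps)
  then have "pderiv P * Q = P * pderiv Q" using assms by simp
  \<comment> \<open>The top coefficient of X S' is deg S times that of S, even for constant S.
    Comparing coefficients in degree deg P + deg Q equates the two degrees in characteristic
    zero.\<close>
  then have "(?X * pderiv P) * Q = P * (?X * pderiv Q)" by (metis mult.assoc mult.left_commute)
  moreover have top: "coeff (?X * pderiv S) (degree S) = of_nat (degree S) * lead_coeff S"
    and le: "degree (?X * pderiv S) \<le> degree S" for S :: "'a poly"
  proof -
    have c: "coeff (?X * pderiv S) i = of_nat i * coeff S i" for i
      by (cases i) (simp_all add: coeff_pCons coeff_pderiv)
    show "coeff (?X * pderiv S) (degree S) = of_nat (degree S) * lead_coeff S" by (rule c)
    show "degree (?X * pderiv S) \<le> degree S"
      by (rule degree_le) (simp add: c coeff_eq_0 del: mult_pCons_left)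
  qed
  ultimately have "of_nat (degree P) * lead_coeff P * lead_coeff Q = lead_coeff P * (of_nat (degree Q) * lead_coeff Q)"
    using coeff_mult_top[OF le order_refl, of P Q] coeff_mult_top[OF order_refl le, of P Q]
    by (simp only: top)
  then show ?thesis using assms(2,3) by simp
qed

text \<open>Dimension count: \<open>P \<mapsto> q P' + r P\<close> raises degrees by at most \<open>e\<close>, so its cokernel has
  dimension at most \<open>e + 1\<close>.\<close>

lemma telescoping_polynomials:
  fixes q r :: "'a::field_char_0 poly" and N :: "nat \<Rightarrow> 'a poly"
  assumes F: "is_subfield F" and q: "q \<in> poly_over F" "q \<noteq> 0" "degree q \<le> e"
    and r: "r \<in> poly_over F" "degree r \<le> e" and N: "\<And>j. j < e + 3 \<Longrightarrow> N j \<in> poly_over F"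
  obtains P a where "P \<in> poly_over F" "\<And>j. a j \<in> F" "\<exists>j<e+3. a j \<noteq> 0"
    "q * pderiv P + r * P = (\<Sum>j<e+3. smult (a j) (N j))"
proof -
  note R = is_subring_subfield[OF F]
  let ?T = "\<lambda>P. q * pderiv P + r * P"
  define D where "D = (\<Sum>j<e+3. degree (N j))"
  have D: "degree (N j) \<le> D" if "j < e + 3" for j
    unfolding D_def using that by (intro member_le_sum) auto
  \<comment> \<open>Any nonzero kernel element has degree \<open>d\<close>, so the condition
    \<open>v d = 0\<close> below excludes the kernel.\<close>
  obtain d where d: "\<And>P. P \<noteq> 0 \<Longrightarrow> ?T P = 0 \<Longrightarrow> degree P = d"
    using first_order_kernel_degree[OF q(2), of _ _ r] by metis
  \<comment> \<open>The images of \<open>D + 1\<close> monomials and the \<open>e + 3\<close> given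
    polynomials have degree at most \<open>D + e\<close>, so they are dependent even under the side
    condition \<open>v d = 0\<close>.\<close>
  define W where "W i = (if i \<le> D then ?T (monom 1 i) else - N (i - Suc D))" for i
  have degT: "degree (?T (monom 1 i)) \<le> D + e" if "i \<le> D" for i
  proof (rule degree_add_le)
    have "degree (q * pderiv (monom 1 i)) \<le> degree q + degree (pderiv (monom (1::'a) i))" by (rule degree_mult_le)
    also have "\<dots> \<le> e + D" using q(3) that by (intro add_mono) (auto simp: degree_pderiv degree_monom_eq)
    finally show "degree (q * pderiv (monom 1 i)) \<le> D + e" by simp
    have "degree (r * monom 1 i) \<le> degree r + degree (monom (1::'a) i)" by (rule degree_mult_le)
    also have "\<dots> \<le> e + D" using r(2) that by (intro add_mono) (auto simp: degree_monom_eq)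
    finally show "degree (r * monom 1 i) \<le> D + e" by simp
  qed
  have W: "W i \<in> poly_over F" "degree (W i) \<le> D + e" if "i < Suc D + (e + 3)" for i
  proof -
    have "- N j \<in> poly_over F" if "j < e + 3" for j
      using poly_over_diff[OF R poly_over_0[OF R] N[OF that]] by simp
    then show "W i \<in> poly_over F"
      unfolding W_def using that q r N subfield_one[OF F]
      by (auto intro!: poly_over_add[OF R] poly_over_mult[OF R] poly_over_pderiv[OF R] poly_over_monom[OF R])
    show "degree (W i) \<le> D + e"
      using degT[of i] le_trans[OF D[of "i - Suc D"], of "D + e"] that by (auto simp: W_def)
  qed
  obtain v where v: "\<And>i. v i \<in> F" "\<exists>i<Suc D + (e + 3). v i \<noteq> 0" "d < Suc D + (e + 3) \<Longrightarrow> v d = 0"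
    "(\<Sum>i<Suc D + (e + 3). smult (v i) (W i)) = 0"
    by (rule polynomials_dependent[OF F W, of "Suc D + (e + 3)" "\<lambda>i. i" d]) auto
  define P where "P = (\<Sum>i<Suc D. smult (v i) (monom 1 i))"
  define a where "a j = v (Suc D + j)" for j
  have coeffP: "coeff P i = (if i \<le> D then v i else 0)" for i
    by (simp add: P_def coeff_sum smult_monom less_Suc_eq_le del: sum.lessThan_Suc)
  have lin: "?T (\<Sum>i\<in>I. smult (v i) (S i)) = (\<Sum>i\<in>I. smult (v i) (?T (S i)))" if "finite I"
    for S :: "nat \<Rightarrow> 'a poly" and I
    using that by (induction I rule: finite_induct)
      (simp_all add: pderiv_add pderiv_smult smult_add_right algebra_simps)
  have split: "(\<Sum>i<Suc D + n. smult (v i) (W i)) =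
      (\<Sum>i<Suc D. smult (v i) (W i)) + (\<Sum>j<n. smult (v (Suc D + j)) (W (Suc D + j)))" for n
    by (induction n) (simp_all add: add.assoc)
  have A: "(\<Sum>i<Suc D. smult (v i) (W i)) = ?T P"
    unfolding P_def lin[OF finite_lessThan] by (intro sum.cong) (auto simp: W_def)
  have B: "(\<Sum>j<e+3. smult (v (Suc D + j)) (W (Suc D + j))) = - (\<Sum>j<e+3. smult (a j) (N j))"
    by (simp add: W_def a_def sum_negf)
  have "?T P + - (\<Sum>j<e+3. smult (a j) (N j)) = 0"
    unfolding A[symmetric] B[symmetric] split[symmetric] by (rule v(4))
  then have TP: "?T P = (\<Sum>j<e+3. smult (a j) (N j))" by simp
  \<comment> \<open>Otherwise \<open>P\<close> would be a nonzero kernel element, hence of degree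
    \<open>d\<close>, while its coefficient in that degree is zero.\<close>
  have "\<exists>j<e+3. a j \<noteq> 0"
  proof (rule ccontr)
    assume "\<not> (\<exists>j<e+3. a j \<noteq> 0)"
    then have z: "a j = 0" if "j < e + 3" for j using that by blast
    then have "?T P = 0" unfolding TP by simp
    obtain i where i: "i < Suc D + (e + 3)" "v i \<noteq> 0" using v(2) by blast
    have "i \<le> D"
    proof (rule ccontr)
      assume "\<not> i \<le> D"
      then have "v i = a (i - Suc D)" by (simp add: a_def)
      then show False using z[of "i - Suc D"] i \<open>\<not> i \<le> D\<close> by simp
    qed
    then have "P \<noteq> 0" using coeffP[of i] i by auto
    then have "degree P = d" using d \<open>?T P = 0\<close> by blast
    then have "coeff P d \<noteq> 0" using \<open>P \<noteq> 0\<close> leading_coeff_0_iff by blast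
    then show False using coeffP[of d] v(3) by (auto split: if_splits)
  qed
  moreover have "P \<in> poly_over F"
    using v(1) subfield_zero[OF F] by (auto simp: poly_over_def coeffP)
  ultimately show ?thesis using that[of P a] v(1) TP by (simp add: a_def)
qed

section \<open>Telescoping for rational functions\<close>

lemma der_poly_const_coeffs:
  fixes D :: "'a::field_char_0 \<Rightarrow> 'a"
  assumes D: "is_derivation D" and "\<And>a. a \<in> F \<Longrightarrow> D a = 0" "P \<in> poly_over F" "D x = 1"
  shows "D (poly P x) = poly (pderiv P) x"
proof -
  have "D (poly P x) = poly (ext_der D 1 0 P) x"
    using assms by (subst poly_ext_der[OF D]) simp_all
  also have "ext_der D 1 0 P = pderiv P"
    using assms by (intro poly_eqI) (simp add: coeff_ext_der[OF D] coeff_pderiv poly_over_def)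
  finally show ?thesis .
qed

text \<open>Looking for \<open>B\<close> with a prescribed power of \<open>q\<close> as denominator
  reduces the equation to one for the numerator, where the dimension count for polynomials
  applies.\<close>

lemma telescoping_localization:
  fixes D :: "'a::field_char_0 \<Rightarrow> 'a" and h :: "nat \<Rightarrow> 'a"
  assumes D: "is_derivation D" and F: "is_subfield F" and DF: "\<And>a. a \<in> F \<Longrightarrow> D a = 0" and Dx: "D x = 1"
    and q: "q \<in> poly_over F" "poly q x \<noteq> 0" and p: "p * poly q x \<in> ring_adjoin F x"
    and h: "\<And>j. \<exists>k. h j * poly q x ^ k \<in> ring_adjoin F x"
  obtains c B n where "\<forall>j. c j \<in> F" "B \<in> field_gen (F \<union> {x})" "h n = (\<Sum>j<n. c j * h j) + (D B + p * B)"
proof -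
  note R = is_subring_subfield[OF F]
  note R' = is_subring_ring_adjoin[OF R, of x]
  let ?q = "poly q x"
  obtain a where a: "a \<in> poly_over F" "p * ?q = poly a x" using p by (rule ring_adjoinE)
  define e where "e = max (degree q) (degree a)"
  obtain k where k: "\<And>j. h j * ?q ^ k j \<in> ring_adjoin F x" using h by metis
  \<comment> \<open>One exponent serves all \<open>e + 3\<close> elements. Clearing
    \<open>Suc m\<close> powers below accounts for the additional pole order that differentiation
    creates.\<close>
  define m where "m = (\<Sum>j<e+3. k j)"
  have "\<exists>N. N \<in> poly_over F \<and> h j * ?q ^ Suc m = poly N x" if "j < e + 3" for j
  proof -
    have "k j \<le> m" unfolding m_def using that by (intro member_le_sum) auto
    then have "?q ^ Suc m = ?q ^ k j * ?q ^ (Suc m - k j)" by (metis le_Suc_eq le_add_diff_inverse power_add)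
    then have "h j * ?q ^ Suc m = (h j * ?q ^ k j) * ?q ^ (Suc m - k j)" by simp
    also have "\<dots> \<in> ring_adjoin F x"
      by (rule subring_mult[OF R' k subring_power[OF R' ring_adjoinI[OF q(1)]]])
    finally show ?thesis by (auto elim!: ring_adjoinE)
  qed
  then obtain N where N: "\<And>j. j < e + 3 \<Longrightarrow> N j \<in> poly_over F"
    "\<And>j. j < e + 3 \<Longrightarrow> h j * ?q ^ Suc m = poly (N j) x" by metis
  \<comment> \<open>With \<open>B\<close> = P / q^m and p q = a, the product (D B + p B) q^(m+1)
    equals q P' + (a - m q') P; this dictates \<open>?r\<close>.\<close>
  let ?r = "a - smult (of_nat m) (pderiv q)"
  have r: "?r \<in> poly_over F"
    using a q subfield_of_nat[OF F]
    by (intro poly_over_diff[OF R] poly_over_smult[OF R] poly_over_pderiv[OF R])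
  have degr: "degree ?r \<le> e"
    by (rule degree_diff_le)
      (auto simp: e_def degree_pderiv intro: le_trans[OF degree_smult_le])
  have q0: "q \<noteq> 0" "degree q \<le> e" using q by (auto simp: e_def)
  obtain P c where P: "P \<in> poly_over F" and c: "\<And>j. c j \<in> F" "\<exists>j<e+3. c j \<noteq> 0"
    and eq: "q * pderiv P + ?r * P = (\<Sum>j<e+3. smult (c j) (N j))"
    using telescoping_polynomials[of F q e ?r N, OF F q(1) q0 r degr N(1)] by blast
  define B where "B = poly P x / ?q ^ m"
  have Bq: "B * ?q ^ m = poly P x" using q by (simp add: B_def)
  have "poly (pderiv P) x = D (B * ?q ^ m)"
    unfolding Bq using der_poly_const_coeffs[OF D DF P Dx] by simp
  then have "?q * poly (pderiv P) x = D B * ?q ^ Suc m + B * (D (?q ^ m) * ?q)"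
    by (simp add: der_mult[OF D] algebra_simps)
  also have "D (?q ^ m) * ?q = of_nat m * poly (pderiv q) x * ?q ^ m"
    unfolding der_power[OF D] using der_poly_const_coeffs[OF D DF q(1) Dx] by simp
  also have "B * (of_nat m * poly (pderiv q) x * ?q ^ m) = of_nat m * poly (pderiv q) x * poly P x"
    unfolding Bq[symmetric] by (simp add: algebra_simps)
  finally have 1: "?q * poly (pderiv P) x = D B * ?q ^ Suc m + of_nat m * poly (pderiv q) x * poly P x" .
  have 2: "p * B * ?q ^ Suc m = poly a x * poly P x"
    unfolding a(2)[symmetric] Bq[symmetric] by (simp add: algebra_simps)
  have "(D B + p * B) * ?q ^ Suc m = poly (q * pderiv P + ?r * P) x"
    unfolding distrib_right 2 using 1 by (simp add: algebra_simps)
  also have "\<dots> = (\<Sum>j<e+3. c j * h j) * ?q ^ Suc m"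
    unfolding eq sum_distrib_right poly_sum by (intro sum.cong refl) (simp add: N(2)[symmetric])
  finally have main: "D B + p * B = (\<Sum>j<e+3. c j * h j)" using q by simp
  \<comment> \<open>Solving for the last \<open>h n\<close> with nonzero coefficient gives the
    recursive form. Since \<open>c n\<close> is constant, dividing by it commutes with
    \<open>D + p\<close>.\<close>
  define n where "n = Max {j. j < e + 3 \<and> c j \<noteq> 0}"
  have fin: "finite {j. j < e + 3 \<and> c j \<noteq> 0}" by simp
  have n: "n < e + 3" "c n \<noteq> 0"
    using Max_in[OF fin] c(2) unfolding n_def by blast+
  have z: "c j = 0" if "j < e + 3" "\<not> j < Suc n" for j
    using Max_ge[OF fin, of j] that unfolding n_def[symmetric] by auto
  have "(\<Sum>j<e+3. c j * h j) = (\<Sum>j<Suc n. c j * h j)"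
    using n z by (intro sum.mono_neutral_right) auto
  then have "c n * h n = (D B + p * B) - (\<Sum>j<n. c j * h j)" using main by simp
  then have "h n = ((D B + p * B) - (\<Sum>j<n. c j * h j)) / c n" using n by (simp add: field_simps)
  also have "\<dots> = (\<Sum>j<n. - c j / c n * h j) + (D B + p * B) / c n"
    by (simp add: diff_divide_distrib sum_divide_distrib sum_negf)
  also have "(D B + p * B) / c n = D (B / c n) + p * (B / c n)"
    using n DF[OF c(1), of n] by (simp add: der_divide[OF D] add_divide_distrib)
  finally have hn: "h n = (\<Sum>j<n. - c j / c n * h j) + (D (B / c n) + p * (B / c n))" .
  have "B / c n \<in> field_gen (F \<union> {x})"
  proof -
    note K = is_subfield_field_gen[of "F \<union> {x}"]
    have FK: "F \<subseteq> field_gen (F \<union> {x})" "x \<in> field_gen (F \<union> {x})" using subset_field_gen by blast+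
    have "poly S x \<in> field_gen (F \<union> {x})" if "S \<in> poly_over F" for S
      using poly_in_subring[OF is_subring_subfield[OF K] poly_over_mono[OF FK(1) that] FK(2)] .
    then show ?thesis
      unfolding B_def using P q c FK by (intro subfield_divide[OF K] subfield_power[OF K]) auto
  qed
  moreover have "- c j / c n \<in> F" for j
    by (intro subfield_divide[OF F] subfield_uminus[OF F] c)
  ultimately show ?thesis using hn that[of "\<lambda>j. - c j / c n" "B / c n" n] by blast
qed

text \<open>The hypothesis on \<open>h\<close> says that each \<open>h j\<close> arises from
  \<open>u\<close> by ring operations and \<open>d\<close>. Such operations create no new poles, so
  a common denominator of \<open>p\<close> and \<open>u\<close> bounds the poles of all of
  them.\<close>

lemma telescoping:
  fixes D d :: "'a::field_char_0 \<Rightarrow> 'a" and h :: "nat \<Rightarrow> 'a"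
  assumes D: "is_derivation D" and F: "is_subfield F" and DF: "\<And>a. a \<in> F \<Longrightarrow> D a = 0" and Dx: "D x = 1"
    and d: "is_derivation d" and dF: "d ` F \<subseteq> F" and dx: "d x = 0"
    and p: "p \<in> field_gen (F \<union> {x})" and u: "u \<in> field_gen (F \<union> {x})"
    and h: "\<And>R j. is_subring R \<Longrightarrow> d ` R \<subseteq> R \<Longrightarrow> u \<in> R \<Longrightarrow> h j \<in> R"
  obtains c B n where "\<forall>j. c j \<in> F" "B \<in> field_gen (F \<union> {x})" "h n = (\<Sum>j<n. c j * h j) + (D B + p * B)"
proof -
  note R = is_subring_subfield[OF F]
  note R' = is_subring_ring_adjoin[OF R, of x]
  have K: "field_gen (F \<union> {x}) = field_gen (insert x F)" by simp
  obtain P1 q1 where 1: "P1 \<in> poly_over F" "q1 \<in> poly_over F" "poly q1 x \<noteq> 0" "poly q1 x * p = poly P1 x"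
    using field_gen_adjoin_fraction[OF F p[unfolded K]] by metis
  obtain P2 q2 where 2: "P2 \<in> poly_over F" "q2 \<in> poly_over F" "poly q2 x \<noteq> 0" "poly q2 x * u = poly P2 x"
    using field_gen_adjoin_fraction[OF F u[unfolded K]] by metis
  define q where "q = q1 * q2"
  have q: "q \<in> poly_over F" "poly q x \<noteq> 0" using 1 2 by (auto simp: q_def intro: poly_over_mult[OF R])
  let ?q = "poly q x"
  have qR: "?q \<in> ring_adjoin F x" using q by (intro ring_adjoinI)
  have "p * ?q = poly (P1 * q2) x" "u * ?q = poly (P2 * q1) x"
    by (simp_all add: q_def 1(4)[symmetric] 2(4)[symmetric])
  then have p': "p * ?q \<in> ring_adjoin F x" and u': "u * ?q \<in> ring_adjoin F x"
    using 1 2 by (simp_all only: ring_adjoinI poly_over_mult[OF R])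
  \<comment> \<open>The localization F[x, 1/q]; it is \<open>d\<close>-stable because
    \<open>d\<close> maps F[x] into itself.\<close>
  let ?S = "{u. \<exists>k. u * ?q ^ k \<in> ring_adjoin F x}"
  have dR: "d v \<in> ring_adjoin F x" if v: "v \<in> ring_adjoin F x" for v
  proof -
    from v obtain P where P: "P \<in> poly_over F" "v = poly P x" by (rule ring_adjoinE)
    have "d v = poly (ext_der d 0 0 P) x"
      using dx by (simp add: poly_ext_der[OF d] P(2))
    then show ?thesis
      using poly_over_ext_der[OF d F dF subfield_zero[OF F] subfield_zero[OF F] P(1)] by (simp only: ring_adjoinI)
  qed
  have S: "is_subring ?S"
    unfolding is_subring_def
  proof (intro conjI ballI)
    show "0 \<in> ?S" "1 \<in> ?S"
      using subring_zero[OF R'] subring_one[OF R'] by (auto intro: exI[of _ 0])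
    fix v w assume "v \<in> ?S" "w \<in> ?S"
    then obtain k l where kl: "v * ?q ^ k \<in> ring_adjoin F x" "w * ?q ^ l \<in> ring_adjoin F x" by blast
    have ql: "?q ^ i \<in> ring_adjoin F x" for i by (rule subring_power[OF R' qR])
    have "(v + w) * ?q ^ (k + l) = (v * ?q ^ k) * ?q ^ l + (w * ?q ^ l) * ?q ^ k"
      "(v - w) * ?q ^ (k + l) = (v * ?q ^ k) * ?q ^ l - (w * ?q ^ l) * ?q ^ k"
      "(v * w) * ?q ^ (k + l) = (v * ?q ^ k) * (w * ?q ^ l)"
      by (simp_all add: power_add algebra_simps)
    then have "(v + w) * ?q ^ (k + l) \<in> ring_adjoin F x" "(v - w) * ?q ^ (k + l) \<in> ring_adjoin F x"
      "(v * w) * ?q ^ (k + l) \<in> ring_adjoin F x"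
      using kl ql by (simp_all only: subring_add[OF R'] subring_diff[OF R'] subring_mult[OF R'])
    then show "v + w \<in> ?S" "v * w \<in> ?S" "v - w \<in> ?S" by blast+
  qed
  have "d ` ?S \<subseteq> ?S"
  proof (rule image_subsetI)
    fix v assume "v \<in> ?S"
    then obtain k where k: "v * ?q ^ k \<in> ring_adjoin F x" by blast
    have "d (v * ?q ^ k) * ?q = v * (d (?q ^ k) * ?q) + d v * ?q ^ Suc k"
      by (simp add: der_mult[OF d] algebra_simps)
    also have "\<dots> = of_nat k * d ?q * (v * ?q ^ k) + d v * ?q ^ Suc k"
      unfolding der_power[OF d] by (simp add: algebra_simps)
    finally have "d v * ?q ^ Suc k = d (v * ?q ^ k) * ?q - of_nat k * d ?q * (v * ?q ^ k)" by simp
    also have "\<dots> \<in> ring_adjoin F x"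
      by (intro subring_diff[OF R'] subring_mult[OF R'] subring_of_nat[OF R'] dR k qR)
    finally show "d v \<in> ?S" by blast
  qed
  moreover have "u \<in> ?S" using u' by (auto intro: exI[of _ 1])
  ultimately have "h j \<in> ?S" for j by (rule h[OF S])
  then have "\<exists>k. h j * ?q ^ k \<in> ring_adjoin F x" for j by blast
  from telescoping_localization[of D F x q p h, OF D F DF Dx q p' this]
  obtain c B n where "\<forall>j. c j \<in> F" "B \<in> field_gen (F \<union> {x})" "h n = (\<Sum>j<n. c j * h j) + (D B + p * B)" .
  then show ?thesis by (rule that)
qed

section \<open>Solutions of \<open>\<delta>\<^sup>2 Y = p \<delta> Y\<close>\<close>

locale ppv_solution = no_new_constants dl M K
  for dl :: "'a::field_char_0 \<Rightarrow> 'a" and M K +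
  fixes dp :: "'a \<Rightarrow> 'a" and p \<eta> :: 'a
  assumes dp: "is_derivation dp" and commute: "\<And>a. dl (dp a) = dp (dl a)"
    and dp_M: "dp ` M \<subseteq> M" and dp_K: "dp ` K \<subseteq> K"
    and p_K: "p \<in> K" and eta_M: "\<eta> \<in> M"
    and eta_eq: "dl (dl \<eta>) = p * dl \<eta>" and eta_nz: "dl \<eta> \<noteq> 0"
begin

definition "g = dl \<eta>"
definition "h = dp g / g"
definition "hs i = (dp ^^ i) h"
definition "es i = (dp ^^ i) \<eta>"

text \<open>\<open>H i\<close> is the quotient of the \<open>i\<close>-th \<partial>-derivative of
  \<open>g\<close> by \<open>g\<close>, a complete Bell polynomial in \<open>h\<close> and its
  derivatives.\<close>

primrec H :: "nat \<Rightarrow> 'a" where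
  "H 0 = 1"
| "H (Suc i) = dp (H i) + h * H i"

lemma hs_0 [simp]: "hs 0 = h" and hs_Suc: "hs (Suc i) = dp (hs i)"
  and es_0 [simp]: "es 0 = \<eta>" and es_Suc: "es (Suc i) = dp (es i)"
  by (simp_all add: hs_def es_def)

lemma dl_in_M: "u \<in> M \<Longrightarrow> dl u \<in> M" and dp_in_M: "u \<in> M \<Longrightarrow> dp u \<in> M"
  and dp_in_K: "u \<in> K \<Longrightarrow> dp u \<in> K"
  using M_stable dp_M dp_K by auto

lemma dp_funpow_K: "u \<in> K \<Longrightarrow> (dp ^^ i) u \<in> K"
  by (induction i) (auto intro: dp_in_K)

lemma g_M: "g \<in> M" and g_nz: "g \<noteq> 0" and dl_g: "dl g = p * g"
  using eta_M eta_nz eta_eq by (auto simp: g_def intro: dl_in_M)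

lemma h_M: "h \<in> M"
  unfolding h_def by (intro subfield_divide[OF M] dp_in_M g_M)

lemma hs_M: "hs i \<in> M" and es_M: "es i \<in> M"
  by (induction i) (auto simp: hs_Suc es_Suc intro: h_M eta_M dp_in_M)

lemma dp_g: "dp g = h * g"
  using g_nz by (simp add: h_def)

text \<open>Logarithmic derivatives with respect to commuting derivations: \<delta>(\<partial>g / g)
  = \<partial>(\<delta>g / g).\<close>

lemma dl_h: "dl h = dp p"
proof -
  have "dl (dp g) = p * dp g + dp p * g"
    by (simp add: commute dl_g der_mult[OF dp])
  then show ?thesis
    using g_nz by (simp add: h_def der_divide[OF D] dl_g field_simps)
qed

lemma dl_hs: "dl (hs i) = (dp ^^ Suc i) p"
  by (induction i) (simp_all add: hs_Suc commute dl_h)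

lemma dl_hs_K: "dl (hs i) \<in> K"
  unfolding dl_hs by (intro dp_funpow_K p_K)

lemma dl_es: "dl (es i) = H i * g"
proof (induction i)
  case (Suc i)
  then show ?case by (simp add: es_Suc commute der_mult[OF dp] dp_g algebra_simps)
qed (simp add: g_def)

lemma dl_product_g: "dl (b * g) = (dl b + p * b) * g"
  by (simp add: der_mult[OF D] dl_g algebra_simps)

lemma homogeneous_solution:
  assumes "b \<in> M" "dl b + p * b = 0"
  shows "b * g \<in> K"
  using assms g_M by (intro const_in_K subfield_mult[OF M]) (auto simp: dl_product_g)

section \<open>Independence when both equations are unsolvable\<close>

definition E :: "nat \<Rightarrow> 'a set" where
  "E n = field_gen (K \<union> hs ` {..<n})"

lemma interm_E_set: "interm (field_gen (K \<union> hs ` J))"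
  using hs_M dl_hs_K by (intro interm_adjoin_primitives[OF interm_K_self]) auto

lemma interm_E: "interm (E n)"
  unfolding E_def by (rule interm_E_set)

lemma hs_in_E: "i < n \<Longrightarrow> hs i \<in> E n"
  unfolding E_def by (rule subsetD[OF subset_field_gen]) simp

lemma E_mono: "m \<le> n \<Longrightarrow> E m \<subseteq> E n"
  unfolding E_def by (intro field_gen_mono) auto

lemma dp_E: "u \<in> E n \<Longrightarrow> dp u \<in> E (Suc n)"
proof -
  have "dp ` E n \<subseteq> E (Suc n)"
    unfolding E_def[of n]
  proof (intro der_field_gen[OF dp interm_subfield[OF interm_E]])
    show "K \<union> hs ` {..<n} \<subseteq> E (Suc n)"
      using interm_K[OF interm_E] hs_in_E[of _ "Suc n"] by fastforce
    have "dp (hs i) \<in> E (Suc n)" if "i < n" for i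
      using hs_in_E[of "Suc i" "Suc n"] that by (simp add: hs_Suc)
    then show "dp ` (K \<union> hs ` {..<n}) \<subseteq> E (Suc n)"
      using interm_K[OF interm_E] dp_in_K by fastforce
  qed
  then show "u \<in> E n \<Longrightarrow> dp u \<in> E (Suc n)" by blast
qed

lemma H_in_E: "H i \<in> E i"
proof (induction i)
  case 0
  then show ?case by (simp add: subfield_one[OF interm_subfield[OF interm_E]])
next
  case (Suc i)
  note F = interm_subfield[OF interm_E, of "Suc i"]
  have "H i \<in> E (Suc i)" using Suc E_mono[of i "Suc i"] by auto
  then show ?case
    using hs_in_E[of 0 "Suc i"] dp_E[OF Suc] by (auto intro!: subfield_add[OF F] subfield_mult[OF F])
qed

text \<open>\<open>filt n k\<close> holds for values of polynomials over \<open>K\<close> in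
  \<open>hs 0\<close>, ..., \<open>hs (n - 1)\<close> of total degree at most \<open>k\<close>. It
  speaks of values because the \<open>hs i\<close> may be algebraically dependent.\<close>

inductive filt :: "nat \<Rightarrow> nat \<Rightarrow> 'a \<Rightarrow> bool" where
  filt_K: "u \<in> K \<Longrightarrow> filt n k u"
| filt_add: "filt n k u \<Longrightarrow> filt n k v \<Longrightarrow> filt n k (u + v)"
| filt_hs: "i < n \<Longrightarrow> filt n k u \<Longrightarrow> filt n (Suc k) (hs i * u)"

lemma filt_mono: "filt n k u \<Longrightarrow> n \<le> n' \<Longrightarrow> k \<le> k' \<Longrightarrow> filt n' k' u"
proof (induction arbitrary: k' rule: filt.induct)
  case (filt_hs i n k u)
  then obtain l where "k' = Suc l" "k \<le> l" by (cases k') auto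
  then show ?case using filt_hs by (auto intro: filt.filt_hs)
qed (auto intro: filt.intros)

lemma filt_scale: "filt n k u \<Longrightarrow> c \<in> K \<Longrightarrow> filt n k (c * u)"
proof (induction rule: filt.induct)
  case (filt_hs i n k u)
  then have "filt n (Suc k) (hs i * (c * u))" by (intro filt.filt_hs)
  then show ?case by (simp add: mult.left_commute)
qed (auto simp: distrib_left intro: filt.intros subfield_mult[OF K])

lemma filt_sum: "(\<And>i. i \<in> I \<Longrightarrow> filt n k (f i)) \<Longrightarrow> filt n k (sum f I)"
  by (induction I rule: infinite_finite_induct) (auto intro: filt.intros subfield_zero[OF K])

text \<open>\<partial> turns \<open>hs i\<close> into \<open>hs (Suc i)\<close> and preserves
  \<open>K\<close>: one more variable may occur, but the total degree does not grow.\<close>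

lemma filt_dp: "filt n k u \<Longrightarrow> filt (Suc n) k (dp u)"
proof (induction rule: filt.induct)
  case (filt_hs i n k u)
  have "filt (Suc n) (Suc k) (hs (Suc i) * u)"
    using filt_hs by (intro filt.filt_hs) (auto intro: filt_mono)
  moreover have "filt (Suc n) (Suc k) (hs i * dp u)"
    using filt_hs by (intro filt.filt_hs) auto
  ultimately show ?case by (auto simp: der_mult[OF dp] hs_Suc add.commute intro: filt_add)
qed (auto simp: der_add[OF dp] intro: filt.intros dp_in_K)

lemma filt_h: "filt (Suc n) k u \<Longrightarrow> filt (Suc n) (Suc k) (h * u)"
  using filt_hs[of 0] by simp

lemma filt_h_power: "filt (Suc n) k (h ^ k)"
  by (induction k) (auto intro: filt_K subfield_one[OF K] filt_h)

text \<open>In the recursion only multiplication by \<open>h\<close> raises the total degree, so a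
  pure power of \<open>h\<close> is the only term of top degree.\<close>

lemma H_leading: "\<exists>w. filt (Suc i) i w \<and> H (Suc i) = h ^ Suc i + w"
proof (induction i)
  case 0
  show ?case using subfield_zero[OF K] by (intro exI[of _ 0]) (auto simp: der_1[OF dp] intro: filt_K)
next
  case (Suc i)
  then obtain w where w: "filt (Suc i) i w" "H (Suc i) = h ^ Suc i + w" by blast
  have "filt (Suc i) (Suc i) (H (Suc i))"
    unfolding w(2) using filt_mono[OF w(1), of "Suc i" "Suc i"]
    by (intro filt_add filt_h_power) simp
  then have 1: "filt (Suc (Suc i)) (Suc i) (dp (H (Suc i)))" by (rule filt_dp)
  have 2: "filt (Suc (Suc i)) (Suc i) (h * w)"
    using filt_mono[OF w(1), of "Suc (Suc i)" i] by (intro filt_h) simp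
  have "H (Suc (Suc i)) = dp (H (Suc i)) + h * (h ^ Suc i + w)"
    using w(2) by (metis H.simps(2))
  then have "H (Suc (Suc i)) = h ^ Suc (Suc i) + (dp (H (Suc i)) + h * w)"
    by (simp only: distrib_left power_Suc add_ac)
  then show ?case using filt_add[OF 1 2] by blast
qed

lemma filt_H: "filt i i (H i)"
proof (cases i)
  case 0
  then show ?thesis by (simp add: filt_K subfield_one[OF K])
next
  case (Suc j)
  obtain w where w: "filt (Suc j) j w" "H (Suc j) = h ^ Suc j + w" using H_leading by blast
  show ?thesis
    unfolding Suc w(2) using filt_mono[OF w(1), of "Suc j" "Suc j"] by (intro filt_add filt_h_power) simp
qed

text \<open>Each factor \<open>hs i\<close> contributes an affine polynomial in \<open>h\<close>, so
  total degree bounds the degree in \<open>h\<close>.\<close>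

lemma filt_polynomial:
  assumes F: "is_subfield F" "K \<subseteq> F"
    and lin: "\<And>i. i < m \<Longrightarrow> \<exists>a\<in>F. \<exists>b\<in>F. hs i = a + b * h"
    and u: "filt n k u" and n: "n = m"
  shows "\<exists>P\<in>poly_over F. degree P \<le> k \<and> u = poly P h"
  using u n
proof (induction rule: filt.induct)
  case (filt_K u n k)
  then show ?case
    using F by (intro bexI[of _ "[:u:]"] poly_over_const is_subring_subfield) auto
next
  case (filt_add n k u v)
  then obtain P Q where "P \<in> poly_over F" "degree P \<le> k" "u = poly P h"
    "Q \<in> poly_over F" "degree Q \<le> k" "v = poly Q h" by blast
  then show ?case
    by (intro bexI[of _ "P + Q"] poly_over_add is_subring_subfield F) (auto intro: degree_add_le)
next
  case (filt_hs i n k u)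
  then obtain P where P: "P \<in> poly_over F" "degree P \<le> k" "u = poly P h" by blast
  obtain a b where ab: "a \<in> F" "b \<in> F" "hs i = a + b * h" using lin filt_hs by blast
  note R = is_subring_subfield[OF F(1)]
  have "degree ([:a, b:] * P) \<le> Suc k"
    using degree_mult_le[of "[:a, b:]" P] P(2) by (auto split: if_splits)
  moreover have "[:a, b:] * P \<in> poly_over F"
    using ab P by (intro poly_over_mult[OF R] poly_over_pCons[OF R] poly_over_0[OF R])
  moreover have "hs i * u = poly ([:a, b:] * P) h"
    by (simp only: ab P poly_mult) (simp add: mult.commute)
  ultimately show ?case by blast
qed

section \<open>Consequences of the first equation being unsolvable\<close>

context
  assumes no_primitive: "\<not> (\<exists>Y\<in>K. dl Y = dp p)"
begin

text \<open>A power of \<open>g\<close> in \<open>E n\<close> is an exponential over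
  \<open>K\<close>, hence in \<open>K\<close>. Its logarithmic \<partial>-derivative
  \<open>k * h\<close> then puts \<open>h\<close> into \<open>K\<close>, where \<open>h\<close>
  would solve the first equation.\<close>

lemma g_power_notin_E:
  assumes "k > 0"
  shows "g ^ k \<notin> E n"
proof
  assume "g ^ k \<in> E n"
  then have gK: "g ^ k \<in> K"
    using g_nz hs_M dl_hs_K p_K der_exp_power[OF D dl_g, of k] unfolding E_def
    by (intro adjoin_primitives_exponential[OF interm_K_self, of "hs ` {..<n}" "g ^ k" "of_nat k * p"])
      (auto intro: subfield_mult[OF K] subfield_of_nat[OF K])
  have "dp (g ^ k) = of_nat k * h * g ^ k" by (rule der_exp_power[OF dp dp_g])
  then have "of_nat k * h = dp (g ^ k) / g ^ k" using g_nz by simp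
  also have "\<dots> \<in> K" by (intro subfield_divide[OF K] dp_in_K gK)
  finally have "h \<in> K"
    using subfield_mult_cancel[OF K subfield_of_nat[OF K], of k h] assms by simp
  then show False using no_primitive dl_h by blast
qed

text \<open>A nonzero solution is a constant multiple of the inverse of \<open>g\<close>, which
  would put \<open>g\<close> into \<open>E n\<close>.\<close>

lemma homogeneous_trivial:
  assumes "b \<in> E n" "dl b + p * b = 0"
  shows "b = 0"
proof (rule ccontr)
  assume "b \<noteq> 0"
  have "b \<in> M" using assms(1) interm_M[OF interm_E] by blast
  then have "b * g \<in> E n" using homogeneous_solution[OF _ assms(2)] interm_K[OF interm_E] by blast
  then have "g \<in> E n"
    using subfield_mult_cancel[OF interm_subfield[OF interm_E] assms(1) \<open>b \<noteq> 0\<close>] by blast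
  then show False using g_power_notin_E[of 1] by simp
qed

lemma g_transcendental: "transcendental_over (E n) g"
proof (rule ccontr)
  assume "\<not> transcendental_over (E n) g"
  moreover have "p \<in> E n" using p_K interm_K[OF interm_E] by blast
  ultimately obtain k where "k > 0" "g ^ k \<in> E n"
    using exponential_algebraic[OF interm_E g_M dl_g g_nz] by blast
  then show False using g_power_notin_E by blast
qed

lemma h_notin_K: "h \<notin> K"
  using no_primitive dl_h by blast

text \<open>An algebraic relation among the derivatives of \<open>\<eta>\<close> is, by Ostrowski's argument over
  \<open>E m (g)\<close>, a linear one; the coefficient of \<open>g\<close> turns it into an inhomogeneous equation.\<close>

lemma algebraic_relation_imp_equation:
  assumes "\<not> d_transcendental_over dp K \<eta>"
  obtains c b m where "\<forall>i. c i \<in> K" "b \<in> E m" "dl b + p * b = H m - (\<Sum>i<m. c i * H i)"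
proof -
  \<comment> \<open>Failing independence, some \<open>es m\<close> is algebraic over the field
    generated by its predecessors.\<close>
  obtain m where m: "\<not> transcendental_over (field_gen (K \<union> es ` {..<m})) (es m)"
    using assms alg_indep_overI[OF K, of es] unfolding d_transcendental_over_def es_def by blast
  note F = interm_subfield[OF interm_E, of m]
  note R = interm_subring[OF interm_E, of m]
  have p_E: "p \<in> E m" using p_K interm_K[OF interm_E] by blast
  define G where "G = field_gen (insert g (E m))"
  have g_G: "g \<in> G" and E_G: "E m \<subseteq> G" unfolding G_def using subset_field_gen by blast+
  have FG: "is_subfield G" unfolding G_def by (rule is_subfield_field_gen)
  have G: "interm G"
    unfolding G_def using p_E subset_field_gen[of "insert g (E m)"]
    by (intro interm_adjoin[OF interm_E g_M]) (auto simp: dl_g intro!: subfield_mult[OF is_subfield_field_gen])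
  have H_E: "H i \<in> E m" if "i \<le> m" for i using H_in_E E_mono[OF that] by blast
  have dl_es_G: "dl (es i) \<in> G" if "i \<le> m" for i
    using H_E[OF that] E_G g_G by (auto simp: dl_es intro: subfield_mult[OF FG])
  define X where "X = field_gen (G \<union> es ` {..<m})"
  have X: "interm X"
    unfolding X_def using es_M dl_es_G by (intro interm_adjoin_primitives[OF G]) auto
  have "field_gen (K \<union> es ` {..<m}) \<subseteq> X"
    unfolding X_def using interm_K[OF G] by (intro field_gen_mono) auto
  then have "\<not> transcendental_over X (es m)" using m transcendental_over_mono by blast
  moreover have "dl (es m) \<in> X" unfolding X_def using dl_es_G[of m] subset_field_gen by blast
  ultimately have "es m \<in> X" by (intro primitive_algebraic[OF X es_M])
  \<comment> \<open>Over \<open>G\<close> the \<open>es i\<close> are primitives, so Ostrowski's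
    theorem turns membership into a linear relation with constant coefficients.\<close>
  then obtain c e where c: "\<And>i. c i \<in> K" "\<And>i. dl (c i) = 0" and e: "e \<in> G" "es m = (\<Sum>i<m. c i * es i) + e"
    using adjoin_primitives_primitive[OF G, of m es "es m"] es_M dl_es_G unfolding X_def by (metis less_imp_le order_refl)
  define r where "r = H m - (\<Sum>i<m. c i * H i)"
  have r_E: "r \<in> E m"
    unfolding r_def using H_E c(1) interm_K[OF interm_E, of m]
    by (intro subfield_diff[OF F] subfield_sum[OF F] subfield_mult[OF F]) auto
  have "dl (es m) = (\<Sum>i<m. c i * (H i * g)) + dl e"
    by (subst e(2)) (simp add: der_add[OF D] der_sum[OF D] der_mult[OF D] c(2) dl_es)
  then have de: "dl e = r * g"
    by (simp add: dl_es r_def left_diff_distrib sum_distrib_right mult.assoc)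
  have "dl e + 0 * e \<in> ring_adjoin (E m) g"
    using base_in_ring_adjoin[OF R r_E] gen_in_ring_adjoin[OF R] de
    by (auto intro: subring_mult[OF is_subring_ring_adjoin[OF R]])
  \<comment> \<open>The remainder \<open>e\<close> is a Laurent polynomial in
    \<open>g\<close>.\<close>
  then obtain d where "g ^ d * e \<in> ring_adjoin (E m) g"
    using adjoin_exponential_denominator[OF interm_E g_M dl_g g_nz g_transcendental p_E
        e(1)[unfolded G_def] subfield_zero[OF F]] by blast
  then obtain P where P: "P \<in> poly_over (E m)" "g ^ d * e = poly P g" by (rule ring_adjoinE)
  have "poly (ext_der dl 0 p P) g = dl (g ^ d * e)"
    by (subst poly_ext_der[OF D]) (simp_all add: dl_g P(2))
  also have "\<dots> = of_nat d * p * (g ^ d * e) + r * g ^ Suc d"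
    by (simp add: der_mult[OF D] der_exp_power[OF D dl_g] de algebra_simps)
  also have "\<dots> = poly (smult (of_nat d * p) P + monom r (Suc d)) g"
    by (simp add: P(2) poly_monom)
  finally have "ext_der dl 0 p P = smult (of_nat d * p) P + monom r (Suc d)"
    using P(1) p_E r_E subfield_of_nat[OF F]
    by (intro transcendental_poly_eq[OF R g_transcendental] poly_over_ext_der[OF D F interm_stable[OF interm_E]]
        poly_over_add[OF R] poly_over_smult[OF R] poly_over_monom[OF R] subfield_zero[OF F] subfield_mult[OF F])
  \<comment> \<open>The coefficient of g^(d+1) in g^d \<open>e\<close> is that of \<open>g\<close>
    in \<open>e\<close>. The shift by \<open>d\<close> cancels, leaving \<delta> + p acting on
    it.\<close>
  from arg_cong[OF this, of "\<lambda>P. coeff P (Suc d)"]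
  have "dl (coeff P (Suc d)) + p * coeff P (Suc d) = r"
    by (simp add: coeff_ext_der[OF D] algebra_simps)
  then show ?thesis
    using c(1) poly_overD[OF P(1)] unfolding r_def by (intro that[of c "coeff P (Suc d)" m] allI)
qed

text \<open>\<open>J\<close> is chosen maximal such that \<open>h\<close> stays outside \<open>K(hs ` J)\<close>.\<close>

lemma exists_complement:
  obtains J where "J \<subseteq> {..<m}" "h \<notin> field_gen (K \<union> hs ` J)"
    "\<And>i. i < m \<Longrightarrow> \<exists>a\<in>field_gen (K \<union> hs ` J). \<exists>b\<in>field_gen (K \<union> hs ` J). hs i = a + b * h"
proof -
  let ?P = "\<lambda>J. J \<subseteq> {..<m} \<and> h \<notin> field_gen (K \<union> hs ` J)"
  have 1: "?P {}" using h_notin_K field_gen_eq[OF K] by simp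
  have 2: "\<forall>J. ?P J \<longrightarrow> card J < Suc m"
    using card_mono[of "{..<m}"] by (auto simp: less_Suc_eq_le)
  from ex_has_greatest_nat[of ?P "{}" card "Suc m", OF 1 2]
  obtain J where "?P J \<and> (\<forall>J'. ?P J' \<longrightarrow> card J' \<le> card J)" by (rule exE)
  then have J: "?P J" and max: "\<And>J'. ?P J' \<Longrightarrow> card J' \<le> card J" by simp_all
  let ?E = "field_gen (K \<union> hs ` J)"
  note I = interm_E_set[of J]
  note F = interm_subfield[OF I]
  have "\<exists>a\<in>?E. \<exists>b\<in>?E. hs i = a + b * h" if i: "i < m" for i
  proof (cases "hs i \<in> ?E")
    case True
    then show ?thesis using subfield_zero[OF F] by (intro bexI[of _ "hs i"] bexI[of _ 0]) auto
  next
    case False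
    then have "i \<notin> J" using subset_field_gen[of "K \<union> hs ` J"] by auto
    then have "card (insert i J) = Suc (card J)" using J finite_subset[of J "{..<m}"] by simp
    then have "\<not> ?P (insert i J)" using max[of "insert i J"] by auto
    then have "h \<in> field_gen (K \<union> hs ` insert i J)" using J i by simp
    also have "\<dots> = field_gen (insert (hs i) ?E)"
      using field_gen_insert_eq[of "K \<union> hs ` J" "{hs i}"] by simp
    finally have h: "h \<in> field_gen (insert (hs i) ?E)" .
    have dlK: "dl (hs j) \<in> ?E" for j using dl_hs_K interm_K[OF I] by blast
    then have "transcendental_over ?E (hs i)" using primitive_algebraic[OF I hs_M] False by blast
    \<comment> \<open>Both \<open>h\<close> and \<open>hs i\<close> are primitives, so
      \<open>h\<close> is affine in \<open>hs i\<close>. As \<open>h\<close> is outside the base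
      field, the slope is nonzero and the relation can be inverted.\<close>
    from adjoin_primitive_primitive[OF I hs_M dlK this h dlK[of 0, unfolded hs_0]]
    obtain c e where ce: "c \<in> K" "e \<in> ?E" "h = c * hs i + e" by metis
    have "c \<noteq> 0" using ce J by auto
    have c: "c \<in> ?E" using ce interm_K[OF I] by blast
    have "hs i = - e / c + inverse c * h" using ce \<open>c \<noteq> 0\<close> by (simp add: field_simps)
    then show ?thesis
      using subfield_divide[OF F subfield_uminus[OF F ce(2)] c] subfield_inverse[OF F c] by blast
  qed
  then show ?thesis using that J by blast
qed

text \<open>Over \<open>E'\<close> the element \<open>h\<close> is transcendental and every
  \<open>hs i\<close> with \<open>i < m\<close> is affine in it. Possible dependencies among the
  \<open>hs i\<close> are thereby absorbed, and both sides can be compared as polynomials in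
  \<open>h\<close>.\<close>

lemma equation_descends:
  assumes c: "\<And>i. c i \<in> K" and b: "b \<in> E m" and eq: "dl b + p * b = H m - (\<Sum>i<m. c i * H i)"
  shows "\<exists>Y\<in>K. dl Y + p * Y = 1"
proof -
  obtain J where J: "J \<subseteq> {..<m}" "h \<notin> field_gen (K \<union> hs ` J)"
    and lin: "\<And>i. i < m \<Longrightarrow> \<exists>a\<in>field_gen (K \<union> hs ` J). \<exists>b\<in>field_gen (K \<union> hs ` J). hs i = a + b * h"
    using exists_complement by metis
  define E' where "E' = field_gen (K \<union> hs ` J)"
  note lin = lin[folded E'_def]
  have I: "interm E'" unfolding E'_def by (rule interm_E_set)
  note F = interm_subfield[OF I]
  note R = interm_subring[OF I]
  have E'_E: "E' \<subseteq> E m" unfolding E'_def E_def using J by (intro field_gen_mono) auto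
  have p_E': "p \<in> E'" using p_K interm_K[OF I] by blast
  have dh: "dl h \<in> E'" using dl_hs_K[of 0] interm_K[OF I] by auto
  then have t: "transcendental_over E' h"
    using primitive_algebraic[OF I h_M] J(2) unfolding E'_def by blast
  have "hs i \<in> field_gen (insert h E')" if i: "i < m" for i
  proof -
    obtain a b where "a \<in> E'" "b \<in> E'" "hs i = a + b * h" using lin[OF i] by blast
    then show ?thesis
      using subset_field_gen[of "insert h E'"]
      by (auto intro!: subfield_add subfield_mult is_subfield_field_gen)
  qed
  then have "E m \<subseteq> field_gen (insert h E')"
    unfolding E_def using interm_K[OF I] subset_field_gen[of "insert h E'"]
    by (intro field_gen_least is_subfield_field_gen) auto
  then have b': "b \<in> field_gen (insert h E')" using b by blast
  \<comment> \<open>\<open>H m\<close> supplies h^m; all other terms on the right have total degree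
    below \<open>m\<close>.\<close>
  have "\<exists>S\<in>poly_over E'. coeff S m = 1 \<and> (\<forall>i>m. coeff S i = 0) \<and> dl b + p * b = poly S h"
  proof (cases m)
    case 0
    then show ?thesis
      using poly_over_1[OF R] eq by (intro bexI[of _ 1]) auto
  next
    case (Suc k)
    obtain w where w: "filt (Suc k) k w" "H (Suc k) = h ^ Suc k + w" using H_leading by blast
    have "filt (Suc k) k (- c i * H i)" if "i < Suc k" for i
      using filt_mono[OF filt_H, of i "Suc k" k] that c by (intro filt_scale subfield_uminus[OF K]) auto
    then have "filt (Suc k) k (w + (\<Sum>i<Suc k. - c i * H i))"
      by (intro filt_add w filt_sum) auto
    from filt_polynomial[OF F interm_K[OF I] lin this Suc[symmetric]]
    obtain W where W: "W \<in> poly_over E'" "degree W \<le> k" "w + (\<Sum>i<Suc k. - c i * H i) = poly W h" by blast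
    have "dl b + p * b = h ^ Suc k + (w + (\<Sum>i<Suc k. - c i * H i))"
      unfolding eq Suc w(2) by (simp add: sum_negf del: sum.lessThan_Suc)
    also have "\<dots> = poly (monom 1 (Suc k) + W) h" unfolding W(3) by (simp add: poly_monom)
    finally show ?thesis
      using W Suc subfield_one[OF F]
      by (intro bexI[of _ "monom 1 (Suc k) + W"] poly_over_add[OF R] poly_over_monom[OF R])
        (auto simp: coeff_eq_0)
  qed
  then obtain S where S: "S \<in> poly_over E'" "coeff S m = 1" "\<And>i. i > m \<Longrightarrow> coeff S i = 0"
    "dl b + p * b = poly S h" by blast
  have "b \<in> ring_adjoin E' h"
    using S by (intro adjoin_primitive_denominator_free[OF I h_M dh t b' p_E']) (auto intro: ring_adjoinI)
  then obtain P where P: "P \<in> poly_over E'" "b = poly P h" by (rule ring_adjoinE)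
  have "poly (ext_der dl (dl h) 0 P + smult p P) h = poly S h"
    unfolding S(4)[symmetric] by (simp, subst poly_ext_der[OF D]) (simp_all add: P)
  then have ext: "ext_der dl (dl h) 0 P + smult p P = S"
    using P(1) p_E' dh S(1) subfield_zero[OF F]
    by (intro transcendental_poly_eq[OF R t] poly_over_add[OF R] poly_over_smult[OF R]
        poly_over_ext_der[OF D F interm_stable[OF I]])
  \<comment> \<open>The coefficient of h^i in the equation involves only those of h^i and h^(i+1) in
    \<open>b\<close>; where the latter vanishes, \<delta> + p acts on a single coefficient.\<close>
  have co: "dl (coeff P i) + p * coeff P i = coeff S i" if "coeff P (Suc i) = 0" for i
    using that by (simp add: coeff_ext_der[OF D] flip: ext)
  have "degree P \<le> m"
  proof (rule ccontr)
    assume deg: "\<not> degree P \<le> m"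
    have "dl (lead_coeff P) + p * lead_coeff P = 0"
      using co[of "degree P"] S(3)[of "degree P"] deg by (simp add: coeff_eq_0)
    moreover have "lead_coeff P \<in> E m" using poly_overD[OF P(1)] E'_E by blast
    ultimately have "lead_coeff P = 0" by (rule homogeneous_trivial[rotated])
    then show False using deg by simp
  qed
  then have 1: "dl (coeff P m) + p * coeff P m = 1"
    using co[of m] S(2) by (simp add: coeff_eq_0)
  \<comment> \<open>\<open>E'\<close> is generated over \<open>K\<close> by primitives and \<delta>
    + p is injective on it, so a solution in \<open>E'\<close> of an equation over \<open>K\<close>
    lies in \<open>K\<close>.\<close>
  have "coeff P m \<in> K"
  proof (rule adjoin_primitives_inhomogeneous[OF interm_K_self, of "hs ` J" "coeff P m" p])
    show "finite (hs ` J)" using J(1) finite_subset by blast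
    show "coeff P m \<in> field_gen (K \<union> hs ` J)" using poly_overD[OF P(1)] by (simp add: E'_def)
    show "e = 0" if "e \<in> field_gen (K \<union> hs ` J)" "dl e + p * e = 0" for e
      using homogeneous_trivial[of e m] that E'_E unfolding E'_def by blast
  qed (use hs_M dl_hs_K p_K 1 subfield_one[OF K] in auto)
  then show ?thesis using 1 by blast
qed

end

lemma d_transcendental_if_unsolvable:
  assumes "\<not> (\<exists>Y\<in>K. dl Y = dp p)" "\<not> (\<exists>Y\<in>K. dl Y + p * Y = 1)"
  shows "d_transcendental_over dp K \<eta>"
proof (rule ccontr)
  assume "\<not> d_transcendental_over dp K \<eta>"
  then obtain c b m where
    "\<forall>i. c i \<in> K" "b \<in> E m" "dl b + p * b = H m - (\<Sum>i<m. c i * H i)"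
    by (rule algebraic_relation_imp_equation[OF assms(1)])
  then show False using equation_descends[OF assms(1), of c b m] assms(2) by blast
qed

section \<open>Dependence when one of the equations is solvable\<close>

definition L :: "nat \<Rightarrow> 'a set" where
  "L n = field_gen (K \<union> es ` {..<n})"

lemma L_subfield: "is_subfield (L n)" and K_L: "K \<subseteq> L n" and es_L: "i < n \<Longrightarrow> es i \<in> L n"
  using subset_field_gen[of "K \<union> es ` {..<n}"] by (auto simp: L_def is_subfield_field_gen)

lemma L_mono: "m \<le> n \<Longrightarrow> L m \<subseteq> L n"
  unfolding L_def by (intro field_gen_mono) auto

lemma dp_L:
  assumes "u \<in> L n"
  shows "dp u \<in> L (Suc n)"
proof -
  have "dp ` L n \<subseteq> L (Suc n)"
    unfolding L_def[of n]
  proof (intro der_field_gen[OF dp L_subfield])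
    show "K \<union> es ` {..<n} \<subseteq> L (Suc n)" using K_L es_L[of _ "Suc n"] by fastforce
    have "dp (es i) \<in> L (Suc n)" if "i < n" for i
      using es_L[of "Suc i" "Suc n"] that by (simp add: es_Suc)
    then show "dp ` (K \<union> es ` {..<n}) \<subseteq> L (Suc n)" using K_L dp_in_K by fastforce
  qed
  then show ?thesis using assms by blast
qed

lemma not_d_transcendental:
  assumes "es n \<in> L n"
  shows "\<not> d_transcendental_over dp K \<eta>"
  using alg_indep_over_notin[OF K, of es n] assms
  unfolding d_transcendental_over_def es_def L_def by blast

text \<open>A \<partial>-stable field containing \<open>es i\<close> contains all later ones, in
  particular \<open>es n\<close>, which then lies in \<open>L n\<close>.\<close>

lemma dp_stable_not_d_transcendental:
  assumes "field_gen (K \<union> A) \<subseteq> L n" "dp ` A \<subseteq> field_gen (K \<union> A)" "es i \<in> field_gen (K \<union> A)" "i \<le> n"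
  shows "\<not> d_transcendental_over dp K \<eta>"
proof -
  have stable: "dp ` field_gen (K \<union> A) \<subseteq> field_gen (K \<union> A)"
    using assms(2) dp_K subset_field_gen[of "K \<union> A"] by (intro der_field_gen_stable[OF dp]) auto
  have "es j \<in> field_gen (K \<union> A)" if "i \<le> j" for j
    using that
  proof (induction j rule: dec_induct)
    case (step j)
    then show ?case using stable by (auto simp: es_Suc)
  qed (rule assms(3))
  then show ?thesis using not_d_transcendental[of n] assms by blast
qed

context
  fixes F :: "'a set" and x :: 'a
  assumes F: "is_subfield F" and dp_F: "dp ` F \<subseteq> F" and dl_F: "\<And>a. a \<in> F \<Longrightarrow> dl a = 0"
    and dl_x: "dl x = 1" and dp_x: "dp x = 0" and K_eq: "K = field_gen (F \<union> {x})"
begin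

lemma F_K: "F \<subseteq> K"
  unfolding K_eq using subset_field_gen by blast

text \<open>\<open>h - Y\<close> is constant, so \<open>h\<close> and all \<open>H j\<close> lie in
  \<open>K\<close>. Telescoping relates them modulo the image of \<delta> + p, and multiplication by
  \<open>g\<close> makes the relation integrable.\<close>

lemma first_solvable:
  assumes Y: "Y \<in> K" "dl Y = dp p"
  shows "\<not> d_transcendental_over dp K \<eta>"
proof -
  have "h - Y \<in> K"
    using Y h_M K_M by (intro const_in_K subfield_diff[OF M]) (auto simp: der_diff[OF D] dl_h)
  then have "(h - Y) + Y \<in> K" using Y by (intro subfield_add[OF K])
  then have h_K: "h \<in> K" by simp
  have H_R: "H j \<in> R" if R: "is_subring R" "dp ` R \<subseteq> R" "h \<in> R" for R j
    using R(2,3) by (induction j) (auto intro: subring_one[OF R(1)] subring_add[OF R(1)] subring_mult[OF R(1)])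
  from telescoping[of dl F x dp p h H, OF D F dl_F dl_x dp dp_F dp_x
      p_K[unfolded K_eq] h_K[unfolded K_eq] H_R, folded K_eq]
  obtain c B n where c': "\<forall>j. c j \<in> F" and B: "B \<in> K"
    and Hn: "H n = (\<Sum>j<n. c j * H j) + (dl B + p * B)" .
  have c: "c j \<in> F" for j using c' by blast
  let ?s = "\<Sum>j<n. c j * es j"
  let ?z = "es n - ?s - B * g"
  have cK: "c j \<in> K" for j using c F_K by blast
  have "dl ?s = (\<Sum>j<n. c j * H j) * g"
    by (simp add: der_sum[OF D] der_mult[OF D] dl_F[OF c] dl_es sum_distrib_right mult.assoc)
  then have "dl ?z = 0"
    by (simp only: der_diff[OF D] dl_es dl_product_g Hn) (simp add: algebra_simps)
  moreover have "?z \<in> M"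
    using es_M g_M B cK K_M by (intro subfield_diff[OF M] subfield_sum[OF M] subfield_mult[OF M]) auto
  ultimately have z: "?z \<in> K" by (intro const_in_K)
  have sL: "?s \<in> field_gen (K \<union> A)" if "es ` {..<n} \<subseteq> A" for A
    using that cK subset_field_gen[of "K \<union> A"]
    by (intro subfield_sum subfield_mult is_subfield_field_gen) auto
  show ?thesis
  proof (cases "B = 0")
    case True
    then have "es n = ?z + ?s" by simp
    also have "\<dots> \<in> L n"
      using sL[of "es ` {..<n}"] z K_L by (intro subfield_add[OF L_subfield]) (auto simp: L_def)
    finally show ?thesis by (rule not_d_transcendental)
  next
    case False
    \<comment> \<open>For nonzero \<open>B\<close> the relation trades \<open>g\<close> for
      \<open>es n\<close>, so K(A) lies in \<open>L (Suc n)\<close>. It is \<partial>-stable because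
      \<open>dp g = h * g\<close> with \<open>h\<close> in \<open>K\<close>.\<close>
    let ?A = "insert g (es ` {..<n})"
    let ?S = "field_gen (K \<union> ?A)"
    have KS: "K \<subseteq> ?S" and AS: "?A \<subseteq> ?S" using subset_field_gen[of "K \<union> ?A"] by auto
    note FS = is_subfield_field_gen[of "K \<union> ?A"]
    have "B * g = es n - ?s - ?z" by simp
    then have "g = (es n - ?s - ?z) / B" using False by (simp add: eq_divide_eq mult.commute)
    also have "\<dots> \<in> L (Suc n)"
    proof -
      have "es ` {..<n} \<subseteq> es ` {..<Suc n}" by auto
      then have "?s \<in> L (Suc n)" unfolding L_def by (rule sL)
      then have "es n - ?s \<in> L (Suc n)" by (intro subfield_diff[OF L_subfield] es_L) simp_all
      from subfield_diff[OF L_subfield this subsetD[OF K_L z]] show ?thesis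
        by (rule subfield_divide[OF L_subfield _ subsetD[OF K_L B]])
    qed
    finally have g_L: "g \<in> L (Suc n)" .
    have "es n = ?z + ?s + B * g" by simp
    also have "\<dots> \<in> ?S"
      using sL[of ?A] z B KS AS by (intro subfield_add[OF FS] subfield_mult[OF FS]) auto
    finally have es_n: "es n \<in> ?S" .
    have "dp (es j) \<in> ?S" if "j < n" for j
      using that es_n AS by (cases "Suc j = n") (auto simp flip: es_Suc)
    moreover have "dp g \<in> ?S"
      unfolding dp_g using h_K KS AS by (intro subfield_mult[OF FS]) auto
    ultimately have "dp ` ?A \<subseteq> ?S" by auto
    moreover have "?S \<subseteq> L (Suc n)"
      using g_L K_L es_L[of _ "Suc n"] by (intro field_gen_least L_subfield) auto
    ultimately show ?thesis
      using es_n by (intro dp_stable_not_d_transcendental[of ?A "Suc n" n]) auto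
  qed
qed

text \<open>\<open>\<eta> - Y * g\<close> is constant, so \<eta> and \<open>g\<close> generate the
  same field over \<open>K\<close>. Telescoping with coefficient 0 relates the
  \<partial>-derivatives of \<open>p\<close> modulo \<delta>-derivatives; integrating relates the
  \<open>hs j\<close> linearly.\<close>

lemma second_solvable:
  assumes Y: "Y \<in> K" "dl Y + p * Y = 1"
  shows "\<not> d_transcendental_over dp K \<eta>"
proof -
  have "dl (\<eta> - Y * g) = 0"
    using Y(2) by (simp add: der_diff[OF D] dl_product_g) (simp add: g_def)
  then have "\<eta> - Y * g \<in> K"
    using Y eta_M g_M K_M by (intro const_in_K subfield_diff[OF M] subfield_mult[OF M]) auto
  then obtain f where f: "f \<in> K" "\<eta> = Y * g + f" by (metis add.commute diff_add_cancel)
  have "Y \<noteq> 0" using Y by (auto simp: der_0[OF D])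
  have R: "(dp ^^ Suc j) p \<in> R" if "is_subring R" "dp ` R \<subseteq> R" "p \<in> R" for R j
    using that(2,3) by (induction j) auto
  from telescoping[of dl F x dp 0 p "\<lambda>j. (dp ^^ Suc j) p", OF D F dl_F dl_x dp dp_F dp_x
      subfield_zero[OF K, unfolded K_eq] p_K[unfolded K_eq] R, folded K_eq]
  obtain c B n where c': "\<forall>j. c j \<in> F" and B: "B \<in> K"
    and Hn: "(dp ^^ Suc n) p = (\<Sum>j<n. c j * (dp ^^ Suc j) p) + (dl B + 0 * B)" .
  have c: "c j \<in> F" for j using c' by blast
  have cK: "c j \<in> K" for j using c F_K by blast
  let ?s = "\<Sum>j<n. c j * hs j"
  let ?z = "hs n - ?s - B"
  have "dl ?s = (\<Sum>j<n. c j * (dp ^^ Suc j) p)"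
    by (simp only: der_sum[OF D] der_mult[OF D] dl_F[OF c] dl_hs mult_zero_left add_0_right)
  then have "dl ?z = 0"
    by (simp only: der_diff[OF D] dl_hs Hn) simp
  moreover have "?z \<in> M"
    using hs_M B cK K_M by (intro subfield_diff[OF M] subfield_sum[OF M] subfield_mult[OF M]) auto
  ultimately have z: "?z \<in> K" by (intro const_in_K)
  \<comment> \<open>K(A) is \<partial>-stable: \<open>dp g = h * g\<close>, and \<open>hs n\<close>
    is expressed through its predecessors.\<close>
  let ?A = "insert g (hs ` {..<n})"
  let ?S = "field_gen (K \<union> ?A)"
  have KS: "K \<subseteq> ?S" and AS: "?A \<subseteq> ?S" using subset_field_gen[of "K \<union> ?A"] by auto
  note FS = is_subfield_field_gen[of "K \<union> ?A"]
  have "hs n = ?z + ?s + B" by simp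
  also have "\<dots> \<in> ?S"
    using z B cK KS AS
    by (intro subfield_add[OF FS] subfield_sum[OF FS] subfield_mult[OF FS]) auto
  finally have hs_n: "hs n \<in> ?S" .
  then have hs_S: "hs j \<in> ?S" if "j \<le> n" for j
    using that AS by (cases "j = n") auto
  have "dp (hs j) \<in> ?S" if "j < n" for j
    using that hs_S[of "Suc j"] by (simp flip: hs_Suc)
  moreover have "dp g \<in> ?S"
    unfolding dp_g using hs_S[of 0] AS by (intro subfield_mult[OF FS]) auto
  ultimately have dpA: "dp ` ?A \<subseteq> ?S" by auto
  have "Y * g = es 0 - f" using f(2) by (metis add_diff_cancel_right' es_0)
  then have "g = (es 0 - f) / Y" using \<open>Y \<noteq> 0\<close> by (simp add: eq_divide_eq mult.commute)
  also have "\<dots> \<in> L 1"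
    using es_L[of 0 1] f Y K_L by (intro subfield_divide[OF L_subfield] subfield_diff[OF L_subfield]) auto
  finally have g_L: "g \<in> L 1" .
  \<comment> \<open>\<open>g\<close> needs only \<open>es 0\<close>, its \<partial>-derivative also
    \<open>es 1\<close>; each further derivative of \<open>h\<close> costs one more.\<close>
  have hs_L: "hs j \<in> L (Suc (Suc j))" for j
  proof (induction j)
    case 0
    have "g \<in> L (Suc (Suc 0))" "dp g \<in> L (Suc (Suc 0))"
      using g_L L_mono[of 1 "Suc (Suc 0)"] dp_L[OF g_L] by auto
    then show ?case unfolding hs_0 h_def by (intro subfield_divide[OF L_subfield])
  qed (simp add: hs_Suc dp_L)
  have "hs j \<in> L (Suc n)" if "j < n" for j
    using hs_L[of j] L_mono[of "Suc (Suc j)" "Suc n"] that by auto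
  then have "?S \<subseteq> L (Suc n)"
    using g_L L_mono[of 1 "Suc n"] K_L by (intro field_gen_least L_subfield) auto
  moreover have "Y * g + f \<in> ?S"
    using f(1) Y KS AS by (intro subfield_add[OF FS] subfield_mult[OF FS]) auto
  then have "es 0 \<in> ?S" by (simp only: es_0 f(2)[symmetric])
  ultimately show ?thesis
    using dpA by (intro dp_stable_not_d_transcendental[of ?A "Suc n" 0]) auto
qed

end

end

section \<open>Application to the PPV extension\<close>

lemma is_PPV_facts:
  assumes "is_PPV dl dp K n r M"
  shows "is_subfield M" "dl ` M \<subseteq> M" "dp ` M \<subseteq> M" "K \<subseteq> M" "consts_of dl M = consts_of dl K"
proof -
  obtain y where M: "M = delta_field_gen dl dp (K \<union> y ` {..<n})" and same_consts: "consts_of dl M = consts_of dl K"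
    using assms unfolding is_PPV_def by blast
  show "is_subfield M"
    unfolding M delta_field_gen_def by (rule is_subfield_Inter) auto
  show "dl ` M \<subseteq> M" "dp ` M \<subseteq> M"
    unfolding M delta_field_gen_def by (intro image_subsetI InterI; elim CollectE; blast)+
  show "K \<subseteq> M"
    unfolding M delta_field_gen_def by blast
  show "consts_of dl M = consts_of dl K" by (rule same_consts)
qed

theorem theorem3p2:
  fixes dl dp :: "'a::field_char_0 \<Rightarrow> 'a"
    and F K M :: "'a set" and x p \<eta> :: 'a
  assumes der_dl: "is_derivation dl" and der_dp: "is_derivation dp"
    and commute: "\<forall>a. dl (dp a) = dp (dl a)"
    and F_field: "is_subfield F" and F_dp: "dp ` F \<subseteq> F"
    and F_closed: "d_closed F dp"
    and dl_F: "\<forall>a\<in>F. dl a = 0"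
    and x_trans: "transcendental_over F x"
    and dl_x: "dl x = 1" and dp_x: "dp x = 0"
    and K_def: "K = field_gen (F \<union> {x})"
    and p_in: "p \<in> K"
    and PPV: "is_PPV dl dp K 2 (\<lambda>i. if i = 1 then - p else 0) M"
    and eta_in: "\<eta> \<in> M"
    and eta_eq: "dl (dl \<eta>) = p * dl \<eta>"
    and eta_nz: "dl \<eta> \<noteq> 0"
  shows "d_transcendental_over dp K \<eta> \<longleftrightarrow>
           (\<not> (\<exists>Y\<in>K. dl Y = dp p)) \<and> (\<not> (\<exists>Y\<in>K. dl Y + p * Y = 1))"
proof -
  note M = is_PPV_facts[OF PPV]
  have K: "is_subfield K" unfolding K_def by (rule is_subfield_field_gen)
  \<comment> \<open>Covers both derivations: \<delta> sends \<open>F\<close> to 0 and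
    \<open>x\<close> to 1, while \<partial> preserves \<open>F\<close> and sends \<open>x\<close> to
    0.\<close>
  have "d ` K \<subseteq> K" if "is_derivation d" "d ` F \<subseteq> F \<union> {0}" "d x \<in> {0, 1}" for d
  proof -
    have "d ` (F \<union> {x}) \<subseteq> K"
      using that(2,3) subfield_zero[OF K] subfield_one[OF K] subset_field_gen[of "F \<union> {x}"]
      unfolding K_def[symmetric] by fastforce
    then show ?thesis unfolding K_def by (intro der_field_gen_stable[OF that(1)])
  qed
  then have "dl ` K \<subseteq> K" "dp ` K \<subseteq> K"
    using der_dl der_dp F_dp dl_F dl_x dp_x by auto
  moreover have "u \<in> K" if "u \<in> M" "dl u = 0" for u
    using that M(5) unfolding consts_of_def by blast
  ultimately interpret ppv_solution dl M K dp p \<eta>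
    using der_dl der_dp commute M K p_in eta_in eta_eq eta_nz by unfold_locales auto
  show ?thesis
    using d_transcendental_if_unsolvable
      first_solvable[OF F_field F_dp _ dl_x dp_x K_def] second_solvable[OF F_field F_dp _ dl_x dp_x K_def] dl_F
    by blast
qed

end
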